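(* Let $\mathcal{P}$ be a homogeneous Poisson process of intensity $1$ on $\mathbb{R}$ and $\mu$ a probability measure on the strictly positive integers. For any translation-invariant matching scheme, $\mathbb{E}^*[M]<\infty$ if and only if $\mathbb{E}[N]<\infty$, where $M$ is the length of the longest edge incident to the origin under the Palm version, and $N$ is the number of points of $[\mathcal{P}]$ that desire the origin.
   Context: Setting. Write $[\mathcal{P}]=\{x\in\mathbb{R}:\mathcal{P}(\{x\})>0\}$ for the point-set of $\mathcal{P}$. Conditionally on $\mathcal{P}$, the points $x\in[\mathcal{P}]$ carry i.i.d. marks $D_x$ with law $\mu$ (the number of stubs at $x$); the resulting marked point process is denoted $(\mathcal{P},\xi)$ with $\xi(\{x\})=D_x$. Matching scheme. A matching scheme for $(\mathcal{P},\xi)$ is a point process $\mathcal{M}$ on the space of unordered pairs of points of $\mathbb{R}$ such that almost surely every pair $(x,y)\in[\mathcal{M}]$ has $x,y\in[\mathcal{P}]$, and in the graph $G$ with vertex set $[\mathcal{P}]$ and edge set $[\mathcal{M}]$ each vertex $x$ has degree exactly $D_x$. All matching schemes are assumed simple (almost surely $G$ has no self-loops and no multiple edges). It is translation-invariant if $\mathcal{M}$ is invariant in law under all translations of $\mathbb{R}$. The length of an edge $(x,y)$ is $|x-y|$. Desire. For $x\in[\mathcal{P}]$, $M_x$ is the length of the longest edge incident to $x$; $x$ desires a site $y\in\mathbb{R}$ if $|y-x|<M_x$. Palm version. $\mathbb{P}^*$ and $\mathbb{E}^*$ denote probability and expectation for the Palm version of $(\mathcal{P},\xi,\mathcal{M})$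 with respect to $\mathcal{P}$ (informally, the law conditioned on there being a point at $0$), and $M=M_0$ in the Palm version; equivalently, since the intensity is $1$, $\mathbb{P}^*(M\in B)=\mathbb{E}\,\#\{x\in[\mathcal{P}]\cap[0,1):M_x\in B\}$ for Borel $B$. *)

theory Defs
  imports "HOL-Probability.Probability" "HOL-Library.Uprod"
begin

text \<open>Unordered pairs carry the quotient topology of the product space.\<close>

instantiation uprod :: (topological_space) topological_space
begin

definition open_uprod :: "'a uprod set \<Rightarrow> bool" where
  "open_uprod U \<longleftrightarrow> open {(x, y). Upair x y \<in> U}"

instance
proof
  show "open (UNIV :: 'a uprod set)"
    by (simp add: open_uprod_def)
  show "open (S \<inter> T)" if "open S" "open T" for S T :: "'a uprod set"
  proof -
    have "{(x, y). Upair x y \<in> S \<inter> T} = {(x, y). Upair x y \<in> S} \<inter> {(x, y). Upair x y \<in> T}"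
      by auto
    then show ?thesis
      using that by (simp add: open_uprod_def open_Int)
  qed
  show "open (\<Union>K)" if "\<forall>S\<in>K. open S" for K :: "'a uprod set set"
  proof -
    have "{(x, y). Upair x y \<in> \<Union>K} = (\<Union>S\<in>K. {(x, y). Upair x y \<in> S})"
      by auto
    then show ?thesis
      using that by (auto simp: open_uprod_def intro!: open_UN)
  qed
qed

end

lift_definition edge_length :: "real uprod \<Rightarrow> real" is "\<lambda>(x, y). \<bar>x - y\<bar>"
  by auto

text \<open>Point configurations are locally finite counting measures; the sigma-algebra on them is the
  one generated by the counts (compare \<^const>\<open>subprob_algebra\<close>). A point process on \<open>'a\<close>
  is a random element of this space.\<close>

definition locally_finite_counting :: "'a::topological_space measure \<Rightarrow> bool" where
  "locally_finite_counting \<nu> \<longleftrightarrow>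
     sets \<nu> = sets borel \<and>
     (\<forall>A\<in>sets borel. emeasure \<nu> A = \<infinity> \<or> emeasure \<nu> A \<in> \<nat>) \<and>
     (\<forall>K. compact K \<longrightarrow> emeasure \<nu> K < \<infinity>)"

definition config_space :: "'a::topological_space measure measure" where
  "config_space =
     (SUP A\<in>sets borel. vimage_algebra {\<nu>. locally_finite_counting \<nu>} (\<lambda>\<nu>. emeasure \<nu> A) borel)"

definition point_process :: "'w measure \<Rightarrow> ('w \<Rightarrow> 'a::topological_space measure) \<Rightarrow> bool" where
  "point_process \<Omega> X \<longleftrightarrow> X \<in> \<Omega> \<rightarrow>\<^sub>M config_space"

definition points :: "'a measure \<Rightarrow> 'a set" where
  "points \<nu> = {x. emeasure \<nu> {x} > 0}"

definition translate :: "real \<Rightarrow> real measure \<Rightarrow> real measure" where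
  "translate t \<nu> = distr \<nu> borel (\<lambda>x. x + t)"

definition translate_pairs :: "real \<Rightarrow> real uprod measure \<Rightarrow> real uprod measure" where
  "translate_pairs t \<nu> = distr \<nu> borel (map_uprod (\<lambda>x. x + t))"

definition poisson_process :: "'w measure \<Rightarrow> real \<Rightarrow> ('w \<Rightarrow> real measure) \<Rightarrow> bool" where
  "poisson_process \<Omega> r P \<longleftrightarrow>
     point_process \<Omega> P \<and>
     (\<forall>B\<in>sets borel. emeasure lborel B < \<infinity> \<longrightarrow>
        (\<forall>k::nat. measure \<Omega> {\<omega>\<in>space \<Omega>. emeasure (P \<omega>) B = of_nat k} =
           exp (- r * measure lborel B) * (r * measure lborel B) ^ k / fact k)) \<and>
     (\<forall>(n::nat) B. (\<forall>i<n. B i \<in> sets borel) \<longrightarrow> disjoint_family_on B {..<n} \<longrightarrow>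
        prob_space.indep_vars \<Omega> (\<lambda>_. borel) (\<lambda>i \<omega>. emeasure (P \<omega>) (B i)) {..<n})"

text \<open>Conditionally on \<open>P\<close>, the masses \<open>\<xi>({x})\<close> at the points \<open>x\<close> of \<open>P\<close> are i.i.d. with law \<open>\<mu>\<close>:
  the points are enumerated without repetition by measurable functions \<open>x n\<close> of the configuration
  \<open>P\<close> alone, and the mark \<open>Y n\<close> of the \<open>n\<close>-th point is such that the \<open>Y n\<close> are i.i.d. and
  independent of \<open>P\<close>. Enumerating by \<^typ>\<open>nat\<close> presupposes that \<open>P\<close> has infinitely many points
  almost surely.\<close>

definition iid_marking ::
    "'w measure \<Rightarrow> ('w \<Rightarrow> real measure) \<Rightarrow> nat pmf \<Rightarrow> ('w \<Rightarrow> real measure) \<Rightarrow> bool" where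
  "iid_marking \<Omega> P \<mu> \<xi> \<longleftrightarrow>
     point_process \<Omega> \<xi> \<and>
     (\<exists>(x :: nat \<Rightarrow> real measure \<Rightarrow> real) (Y :: nat \<Rightarrow> 'w \<Rightarrow> nat).
        (\<forall>n. x n \<in> config_space \<rightarrow>\<^sub>M borel) \<and>
        (AE \<omega> in \<Omega>. bij_betw (\<lambda>n. x n (P \<omega>)) UNIV (points (P \<omega>))) \<and>
        prob_space.indep_vars \<Omega> (\<lambda>_. count_space UNIV) Y UNIV \<and>
        (\<forall>n. distr \<Omega> (count_space UNIV) (Y n) = measure_pmf \<mu>) \<and>
        prob_space.indep_set \<Omega>
          (sets (vimage_algebra (space \<Omega>) P config_space))
          (sets (vimage_algebra (space \<Omega>) (\<lambda>\<omega> n. Y n \<omega>) (\<Pi>\<^sub>M n\<in>UNIV. count_space UNIV))) \<and>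
        (AE \<omega> in \<Omega>. \<forall>n. emeasure (\<xi> \<omega>) {x n (P \<omega>)} = of_nat (Y n \<omega>))) \<and>
     (AE \<omega> in \<Omega>. points (\<xi> \<omega>) \<subseteq> points (P \<omega>))"

definition incident :: "'a uprod set \<Rightarrow> 'a \<Rightarrow> 'a uprod set" where
  "incident E x = {e \<in> E. x \<in> set_uprod e}"

text \<open>Matching schemes are simple by convention: no self-loops (\<^const>\<open>proper_uprod\<close>) and no
  multiple edges, so the degree of \<open>x\<close> is the number of incident edges.\<close>

definition matching_scheme ::
    "'w measure \<Rightarrow> ('w \<Rightarrow> real measure) \<Rightarrow> ('w \<Rightarrow> real measure) \<Rightarrow> ('w \<Rightarrow> real uprod measure) \<Rightarrow> bool"
  where
  "matching_scheme \<Omega> P \<xi> M \<longleftrightarrow>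
     point_process \<Omega> M \<and>
     (AE \<omega> in \<Omega>. \<forall>e\<in>points (M \<omega>). set_uprod e \<subseteq> points (P \<omega>)) \<and>
     (AE \<omega> in \<Omega>. \<forall>e\<in>points (M \<omega>). proper_uprod e \<and> emeasure (M \<omega>) {e} = 1) \<and>
     (AE \<omega> in \<Omega>. \<forall>x\<in>points (P \<omega>).
        finite (incident (points (M \<omega>)) x) \<and>
        of_nat (card (incident (points (M \<omega>)) x)) = emeasure (\<xi> \<omega>) {x})"

definition translation_invariant :: "'w measure \<Rightarrow> ('w \<Rightarrow> real uprod measure) \<Rightarrow> bool" where
  "translation_invariant \<Omega> M \<longleftrightarrow>
     (\<forall>t. distr \<Omega> config_space (\<lambda>\<omega>. translate_pairs t (M \<omega>)) = distr \<Omega> config_space M)"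

definition longest_edge :: "real uprod measure \<Rightarrow> real \<Rightarrow> real" where
  "longest_edge m x = Max (edge_length ` incident (points m) x)"

definition desires :: "real uprod measure \<Rightarrow> real \<Rightarrow> real \<Rightarrow> bool" where
  "desires m x y \<longleftrightarrow> \<bar>y - x\<bar> < longest_edge m x"

definition number_desiring :: "real measure \<Rightarrow> real uprod measure \<Rightarrow> real \<Rightarrow> ennreal" where
  "number_desiring p m y = emeasure (count_space UNIV) {x \<in> points p. desires m x y}"

text \<open>Law of the Palm version of \<open>(P, \<xi>, M)\<close> with respect to \<open>P\<close>: an event \<open>A\<close> gets the expected
  number of points \<open>x \<in> [0, 1)\<close> of \<open>P\<close> for which the configuration seen from \<open>x\<close> lies in \<open>A\<close>. No
  normalisation is included: this is a probability measure when \<open>P\<close> has intensity 1.\<close>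

definition palm_law ::
    "'w measure \<Rightarrow> ('w \<Rightarrow> real measure) \<Rightarrow> ('w \<Rightarrow> real measure) \<Rightarrow> ('w \<Rightarrow> real uprod measure) \<Rightarrow>
     (real measure \<times> real measure \<times> real uprod measure) measure" where
  "palm_law \<Omega> P \<xi> M =
     measure_of (space (config_space \<Otimes>\<^sub>M config_space \<Otimes>\<^sub>M config_space))
       (sets (config_space \<Otimes>\<^sub>M config_space \<Otimes>\<^sub>M config_space))
       (\<lambda>A. \<integral>\<^sup>+\<omega>. emeasure (count_space UNIV)
          {x \<in> points (P \<omega>) \<inter> {0..<1}.
             (translate (- x) (P \<omega>), translate (- x) (\<xi> \<omega>), translate_pairs (- x) (M \<omega>)) \<in> A} \<partial>\<Omega>)"

end

theory Submission
  imports Defs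
begin

text \<open>Let \<open>\<phi>(r)\<close> (\<open>mean_long\<close> below) be the expected number of points of the process in \<open>[0, 1)\<close> that have
  an incident edge longer than \<open>r\<close>. Both expectations in the theorem are finite exactly when
  \<open>\<Sum>j. \<phi>(j)\<close> is finite, the sum ranging over the natural numbers.

  For the Palm expectation this is the layer formula: a nonnegative number \<open>l\<close> lies between the
  number of \<open>j\<close> with \<open>j + 1 < l\<close> and the number of \<open>j\<close> with \<open>j < l\<close>, and \<open>\<phi>(r)\<close> is the Palm measure of
  the event that the longest edge at the origin exceeds \<open>r\<close>. Hence
  \<open>\<Sum>j. \<phi>(j + 1) \<le> E*[M] \<le> \<Sum>j. \<phi>(j)\<close> (\<open>expectation_palm_longest_edge_bounds\<close>).

  For \<open>E[N]\<close> the real line is cut into unit intervals. A point of \<open>[j, j + 1)\<close> whose longest edge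
  exceeds \<open>j + 1\<close> desires the origin, and a point of \<open>[j, j + 1)\<close> or \<open>[- j - 1, - j)\<close> that desires
  the origin has an edge longer than \<open>j\<close>. By translation invariance each of these intervals
  contains on average \<open>\<phi>(r)\<close> points with an edge longer than \<open>r\<close>, so \<open>\<Sum>j. \<phi>(j + 1) \<le> E[N] \<le> 2 (\<Sum>j. \<phi>(j))\<close>
  (\<open>expectation_desiring_bounds\<close>). This is a mass transport argument between unit intervals.
  The two tail sums differ by \<open>\<phi>(0)\<close>, which is at most the
  intensity of the Poisson process (\<open>mean_long_finite\<close>).

  Invariance is a statement about the law of the edge process alone. The points of the Poisson
  process can be recovered from the edges because all marks are positive: almost surely they
  are the endpoints of the edges (\<open>long_vertices_matching_scheme\<close>). What remains is measurability.
  The number of endpoints of long edges in an interval must be a measurable function of the edge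
  configuration (\<open>measurable_ecard_long_vertices\<close>), which rests on the fact that a locally finite counting
  measure charges a set only through atoms (\<open>atom_exists\<close>). The Palm law is given by a formula on
  events; that the formula is countably additive (\<open>emeasure_palm_law\<close>) rests on the
  measurability of a configuration shifted by a random amount (\<open>measurable_random_shift\<close>).\<close>

section \<open>Unordered pairs of reals\<close>

text \<open>The smaller and the larger element are continuous functions on the quotient space of
  unordered pairs and together determine the pair, so they serve as measurable coordinates.\<close>

lift_definition lower_end :: "real uprod \<Rightarrow> real" is "\<lambda>(x, y). min x y"
  by (auto simp: min.commute)

lift_definition upper_end :: "real uprod \<Rightarrow> real" is "\<lambda>(x, y). max x y"
  by (auto simp: max.commute)

lemma lower_end_Upair [simp]: "lower_end (Upair x y) = min x y"
  by transfer simp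

lemma upper_end_Upair [simp]: "upper_end (Upair x y) = max x y"
  by transfer simp

lemma edge_length_Upair [simp]: "edge_length (Upair x y) = \<bar>x - y\<bar>"
  by transfer simp

lemma edge_length_eq: "edge_length e = upper_end e - lower_end e"
  by (cases e) auto

lemma set_uprod_eq: "set_uprod e = {lower_end e, upper_end e}"
  by (cases e) (auto simp: min_def max_def)

lemma Upair_lower_upper [simp]: "Upair (lower_end e) (upper_end e) = e"
  by (cases e) (auto simp: min_def max_def)

lemma continuous_on_Upair: "continuous_on UNIV (\<lambda>(x::'a::topological_space, y). Upair x y)"
  by (auto simp: continuous_on_open_vimage open_uprod_def vimage_def case_prod_unfold)

lemma borel_measurable_Upair [measurable]: "(\<lambda>(x::real, y). Upair x y) \<in> borel \<Otimes>\<^sub>M borel \<rightarrow>\<^sub>M borel"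
  using borel_measurable_continuous_onI[OF continuous_on_Upair] by (simp add: borel_prod)

lemma continuous_on_uprodI:
  fixes f :: "'a::topological_space uprod \<Rightarrow> 'b::topological_space"
  assumes "continuous_on UNIV (\<lambda>(x, y). f (Upair x y))"
  shows "continuous_on UNIV f"
  using assms by (auto simp: continuous_on_open_vimage open_uprod_def vimage_def case_prod_unfold)

lemma borel_measurable_lower_end [measurable]: "lower_end \<in> borel_measurable borel"
  by (intro borel_measurable_continuous_onI continuous_on_uprodI)
     (auto simp: case_prod_unfold intro!: continuous_intros)

lemma borel_measurable_upper_end [measurable]: "upper_end \<in> borel_measurable borel"
  by (intro borel_measurable_continuous_onI continuous_on_uprodI)
     (auto simp: case_prod_unfold intro!: continuous_intros)

definition pair_box :: "nat \<Rightarrow> real uprod set" where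
  "pair_box n = {e. - real n \<le> lower_end e \<and> upper_end e \<le> real n}"

lemma compact_pair_box: "compact (pair_box n)"
proof -
  have "pair_box n = (\<lambda>(x, y). Upair x y) ` ({- real n..real n} \<times> {- real n..real n})"
  proof (intro set_eqI iffI)
    fix e assume e: "e \<in> pair_box n"
    have "lower_end e \<le> upper_end e" by (cases e) auto
    with e have "(lower_end e, upper_end e) \<in> {- real n..real n} \<times> {- real n..real n}"
      by (auto simp: pair_box_def)
    then show "e \<in> (\<lambda>(x, y). Upair x y) ` ({- real n..real n} \<times> {- real n..real n})"
      by (rule rev_image_eqI) simp
  qed (auto simp: pair_box_def)
  then show ?thesis
    by (auto intro!: compact_continuous_image compact_Times
          continuous_on_subset[OF continuous_on_Upair])
qed

lemma pair_box_borel [measurable]: "pair_box n \<in> sets borel"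
  unfolding pair_box_def by measurable

lemma incseq_pair_box: "incseq pair_box"
  by (auto simp: incseq_def pair_box_def)

lemma UN_pair_box: "(\<Union>n. pair_box n) = UNIV"
proof (intro set_eqI iffI UNIV_I)
  fix e
  obtain n where "max (- lower_end e) (upper_end e) \<le> real n"
    using real_arch_simple by blast
  then show "e \<in> (\<Union>n. pair_box n)"
    by (auto simp: pair_box_def intro!: exI[of _ n])
qed

section \<open>Point configurations\<close>

lemma space_config_space: "space (config_space :: 'a::topological_space measure measure) = {\<nu>. locally_finite_counting \<nu>}"
proof -
  have "space (config_space :: 'a measure measure) =
      (\<Union>A\<in>sets (borel::'a measure). {\<nu>. locally_finite_counting \<nu>})"
    unfolding config_space_def by (subst space_Sup_eq_UN) auto
  then show ?thesis
    using sets.empty_sets by fastforce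
qed

lemma measurable_emeasure_config_space:
  assumes "A \<in> sets borel"
  shows "(\<lambda>\<nu>. emeasure \<nu> A) \<in> borel_measurable (config_space :: 'a::topological_space measure measure)"
  unfolding config_space_def
  by (rule measurable_SUP1[OF assms]) (auto intro: measurable_vimage_algebra1)

text \<open>The sigma-algebra on configurations is generated by the counts, so these are all that has to be
  checked.\<close>

lemma measurable_config_spaceI:
  assumes "\<And>\<omega>. \<omega> \<in> space N \<Longrightarrow> locally_finite_counting (X \<omega> :: 'a::topological_space measure)"
    and "\<And>A. A \<in> sets borel \<Longrightarrow> (\<lambda>\<omega>. emeasure (X \<omega>) A) \<in> borel_measurable N"
  shows "X \<in> N \<rightarrow>\<^sub>M config_space"
  unfolding config_space_def
  using assms sets.empty_sets[of borel]
  by (intro measurable_SUP2 measurable_vimage_algebra2) auto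

lemma measurable_config_spaceD:
  "X \<in> N \<rightarrow>\<^sub>M config_space \<Longrightarrow> \<omega> \<in> space N \<Longrightarrow> locally_finite_counting (X \<omega>)"
  using measurable_space[of X N config_space] by (auto simp: space_config_space)

lemma borel_measurable_emeasure_config [measurable (raw)]:
  assumes "X \<in> N \<rightarrow>\<^sub>M config_space" "A \<in> sets borel"
  shows "(\<lambda>\<omega>. emeasure (X \<omega>) A) \<in> borel_measurable N"
  using measurable_compose[OF assms(1) measurable_emeasure_config_space[OF assms(2)]] .

text \<open>Integer values leave no room for a diffuse part: a subset of \<open>B\<close> of least positive mass cannot be
  split, so each set of a countable separating family contains all of its mass or none.
  Intersecting over the family leaves a single point that carries the mass.\<close>

lemma atom_exists:
  fixes \<nu> :: "'a::topological_space measure" and K :: "nat \<Rightarrow> 'a set" and S :: "nat \<Rightarrow> 'a set"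
  assumes lfc: "locally_finite_counting \<nu>"
    and K: "\<And>n. compact (K n)" "\<And>n. K n \<in> sets borel" "(\<Union>n. K n) = UNIV"
    and S: "\<And>i. S i \<in> sets borel" "\<And>x y. (\<And>i. x \<in> S i \<longleftrightarrow> y \<in> S i) \<Longrightarrow> x = y"
    and B: "B \<in> sets borel" "emeasure \<nu> B > 0"
  shows "\<exists>x\<in>B. x \<in> points \<nu>"
proof -
  have sets: "sets \<nu> = sets borel"
    and nat: "\<And>A. A \<in> sets borel \<Longrightarrow> emeasure \<nu> A < \<infinity> \<Longrightarrow> emeasure \<nu> A \<in> \<nat>"
    and fin: "\<And>n. emeasure \<nu> (K n) < \<infinity>"
    using lfc K(1) by (auto simp: locally_finite_counting_def)
  have "\<exists>n. emeasure \<nu> (B \<inter> K n) \<noteq> 0"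
  proof (rule ccontr)
    assume "\<not> ?thesis"
    then have "emeasure \<nu> (\<Union>n. B \<inter> K n) = 0"
      using B K by (intro emeasure_UN_eq_0) (auto simp: sets)
    moreover have "(\<Union>n. B \<inter> K n) = B" using K(3) by auto
    ultimately show False using B by simp
  qed
  then obtain n where n: "emeasure \<nu> (B \<inter> K n) \<noteq> 0" by blast
  have sub: "\<exists>k::nat. emeasure \<nu> C = of_nat k" if "C \<in> sets borel" "C \<subseteq> K n" for C
  proof -
    have "emeasure \<nu> C \<le> emeasure \<nu> (K n)"
      using that K(2) by (intro emeasure_mono) (auto simp: sets)
    then have "emeasure \<nu> C \<in> \<nat>"
      using nat that fin[of n] by (meson order.strict_trans1)
    then show ?thesis by (auto elim: Nats_cases)
  qed
  define Q where "Q k \<longleftrightarrow> k > 0 \<and> (\<exists>C\<in>sets borel. C \<subseteq> B \<inter> K n \<and> emeasure \<nu> C = of_nat k)" for k :: nat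
  obtain k where "emeasure \<nu> (B \<inter> K n) = of_nat k"
    using sub[of "B \<inter> K n"] B K by auto
  then have "Q k" using n B K by (auto simp: Q_def intro!: bexI[of _ "B \<inter> K n"] Nat.gr0I)
  then have "Q (LEAST k. Q k)" by (rule LeastI)
  then obtain C where C: "C \<in> sets borel" "C \<subseteq> B \<inter> K n"
      "emeasure \<nu> C = of_nat (LEAST k. Q k)" "(LEAST k. Q k) > 0"
    by (auto simp: Q_def)
  \<comment> \<open>Both parts have integer mass, and minimality of the mass of \<open>C\<close> forbids that both are positive.\<close>
  have zero_one: "emeasure \<nu> (C \<inter> T) = 0 \<or> emeasure \<nu> (C - T) = 0" if T: "T \<in> sets borel" for T
  proof (rule ccontr)
    assume neg: "\<not> ?thesis"
    obtain a where a: "emeasure \<nu> (C \<inter> T) = of_nat a"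
      using sub[of "C \<inter> T"] C T by auto
    obtain b where b: "emeasure \<nu> (C - T) = of_nat b"
      using sub[of "C - T"] C T by auto
    have "Q a" using neg a C T by (auto simp: Q_def intro!: bexI[of _ "C \<inter> T"] Nat.gr0I)
    then have "(LEAST k. Q k) \<le> a" by (rule Least_le)
    moreover have "emeasure \<nu> C = emeasure \<nu> (C \<inter> T) + emeasure \<nu> (C - T)"
      using C(1) T plus_emeasure[of "C \<inter> T" \<nu> "C - T"] by (simp add: sets Int_Diff_Un Int_Diff_disjoint)
    then have "(LEAST k. Q k) = a + b"
      using a b C by (metis of_nat_add of_nat_eq_iff)
    moreover have "b > 0" using neg b by (auto intro: Nat.gr0I)
    ultimately show False by linarith
  qed
  define D where "D i = (if emeasure \<nu> (C \<inter> S i) = 0 then C \<inter> S i else C - S i)" for i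
  have D: "D i \<in> sets borel" "emeasure \<nu> (D i) = 0" for i
    using zero_one[of "S i"] S C by (auto simp: D_def)
  define E where "E = C - (\<Union>i. D i)"
  have "emeasure \<nu> (\<Union>i. D i) = 0"
    using D by (intro emeasure_UN_eq_0) (auto simp: sets)
  then have E: "emeasure \<nu> E = emeasure \<nu> C"
    unfolding E_def using C D by (intro emeasure_Diff_null_set) (auto simp: sets null_sets_def)
  then have pos: "emeasure \<nu> E > 0" using C by simp
  then obtain x where x: "x \<in> E" by (cases "E = {}") auto
  have mem: "e \<in> S i \<longleftrightarrow> emeasure \<nu> (C \<inter> S i) \<noteq> 0" if "e \<in> E" for e i
  proof -
    have "e \<in> C" "e \<notin> D i" using that by (auto simp: E_def)
    then show ?thesis by (cases "emeasure \<nu> (C \<inter> S i) = 0") (simp_all add: D_def)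
  qed
  have "y = x" if "y \<in> E" for y
  proof (rule S(2))
    show "y \<in> S i \<longleftrightarrow> x \<in> S i" for i
      unfolding mem[OF x] mem[OF that] ..
  qed
  with x have "E = {x}" by blast
  with pos x C show ?thesis by (auto simp: points_def E_def)
qed

text \<open>Comparing either end with a rational number gives a countable separating family, so the
  existence of atoms applies to pairs. The events \<open>emeasure \<nu> B > 0\<close> on the left are measurable in \<open>\<nu>\<close>,
  which makes the existence statement on the right measurable too.\<close>

lemma pair_atom_iff:
  fixes \<nu> :: "real uprod measure"
  assumes lfc: "locally_finite_counting \<nu>" and B: "B \<in> sets borel"
  shows "emeasure \<nu> B > 0 \<longleftrightarrow> (\<exists>e\<in>B. e \<in> points \<nu>)"
proof
  define S :: "nat \<Rightarrow> real uprod set" where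
    "S i = (case from_nat i of (b, q) \<Rightarrow> {e. (if b then lower_end e else upper_end e) < real_of_rat q})" for i
  have S: "S i \<in> sets borel" for i
    unfolding S_def by (auto split: prod.split)
  have sep: "x = y" if xy: "\<And>i. x \<in> S i \<longleftrightarrow> y \<in> S i" for x y
  proof -
    have *: "s = t" if "\<And>q. (s < real_of_rat q) = (t < real_of_rat q)" for s t
      using that of_rat_dense[of s t] of_rat_dense[of t s]
      by (metis less_irrefl linorder_neqE order_less_imp_not_less)
    have "(lower_end x < real_of_rat q) = (lower_end y < real_of_rat q)" for q
      using xy[of "to_nat (True, q)"] by (simp add: S_def)
    moreover have "(upper_end x < real_of_rat q) = (upper_end y < real_of_rat q)" for q
      using xy[of "to_nat (False, q)"] by (simp add: S_def)
    ultimately show "x = y" using * by (metis Upair_lower_upper)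
  qed
  show "\<exists>e\<in>B. e \<in> points \<nu>" if "emeasure \<nu> B > 0"
    by (rule atom_exists[OF lfc compact_pair_box pair_box_borel UN_pair_box S sep B that])
next
  assume "\<exists>e\<in>B. e \<in> points \<nu>"
  then obtain e where e: "e \<in> B" "emeasure \<nu> {e} > 0" by (auto simp: points_def)
  then have "emeasure \<nu> {e} \<le> emeasure \<nu> B"
    using B lfc by (intro emeasure_mono) (auto simp: locally_finite_counting_def)
  with e show "emeasure \<nu> B > 0" by simp
qed

lemma finite_atoms:
  fixes \<nu> :: "'a::topological_space measure"
  assumes lfc: "locally_finite_counting \<nu>" and B: "B \<in> sets borel" "emeasure \<nu> B < \<infinity>"
  shows "finite (points \<nu> \<inter> B)" "of_nat (card (points \<nu> \<inter> B)) \<le> emeasure \<nu> B"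
proof -
  have sets: "sets \<nu> = sets borel"
    and nat: "\<And>A. A \<in> sets borel \<Longrightarrow> emeasure \<nu> A = \<infinity> \<or> emeasure \<nu> A \<in> \<nat>"
    using lfc by (auto simp: locally_finite_counting_def)
  have single: "{x} \<in> sets borel" "emeasure \<nu> {x} \<ge> 1" if "x \<in> points \<nu>" for x
  proof -
    have ne: "emeasure \<nu> {x} \<noteq> 0" using that by (simp add: points_def)
    then show *: "{x} \<in> sets borel" using emeasure_notin_sets[of "{x}" \<nu>] sets by auto
    show "emeasure \<nu> {x} \<ge> 1"
      using nat[OF *] ne by (auto elim!: Nats_cases)
  qed
  have bound: "of_nat (card F) \<le> emeasure \<nu> B" if F: "finite F" "F \<subseteq> points \<nu> \<inter> B" for F
  proof -
    have "of_nat (card F) = (\<Sum>x\<in>F. 1::ennreal)" by simp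
    also have "\<dots> \<le> (\<Sum>x\<in>F. emeasure \<nu> {x})"
      using F single by (intro sum_mono) auto
    also have "\<dots> = emeasure \<nu> (\<Union>x\<in>F. {x})"
      using F single by (intro sum_emeasure) (auto simp: sets disjoint_family_on_def)
    also have "\<dots> \<le> emeasure \<nu> B"
      using F B by (intro emeasure_mono) (auto simp: sets)
    finally show ?thesis .
  qed
  show fin: "finite (points \<nu> \<inter> B)"
  proof (rule ccontr)
    assume inf: "infinite (points \<nu> \<inter> B)"
    obtain n :: nat where n: "emeasure \<nu> B < of_nat n"
      using ennreal_Ex_less_of_nat B by auto
    obtain F where "finite F" "card F = n" "F \<subseteq> points \<nu> \<inter> B"
      using infinite_arbitrarily_large[OF inf] by blast
    with bound[of F] n show False using leD by blast
  qed
  show "of_nat (card (points \<nu> \<inter> B)) \<le> emeasure \<nu> B" using bound[OF fin] by simp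
qed


section \<open>Shifting a configuration by a random amount\<close>

text \<open>A monotone class argument in \<open>C\<close>: for a rectangle the value is an indicator times a count.
  Closure under complements needs finite mass, which is obtained by first intersecting with the
  compact sets \<open>K n\<close>.\<close>

lemma measurable_emeasure_random_section:
  fixes X :: "'w \<Rightarrow> 'a::topological_space measure" and K :: "nat \<Rightarrow> 'a set"
  assumes X: "X \<in> N \<rightarrow>\<^sub>M config_space" and f: "f \<in> N \<rightarrow>\<^sub>M L"
    and K: "\<And>n. compact (K n)" "\<And>n. K n \<in> sets borel" "incseq K" "(\<Union>n. K n) = UNIV"
    and C: "C \<in> sets (L \<Otimes>\<^sub>M borel)"
  shows "(\<lambda>\<omega>. emeasure (X \<omega>) (Pair (f \<omega>) -` C)) \<in> borel_measurable N"
proof -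
  have lfc: "locally_finite_counting (X \<omega>)" if "\<omega> \<in> space N" for \<omega>
    using measurable_config_spaceD[OF X that] .
  have sets: "sets (X \<omega>) = sets borel" "space (X \<omega>) = UNIV" if "\<omega> \<in> space N" for \<omega>
    using lfc[OF that] sets_eq_imp_space_eq[of "X \<omega>" borel] by (auto simp: locally_finite_counting_def)
  have sect: "Pair t -` D \<in> sets borel" if "D \<in> sets (L \<Otimes>\<^sub>M borel)" for t D
    using sets_Pair1[OF that] .
  have part: "(\<lambda>\<omega>. emeasure (X \<omega>) (K n \<inter> Pair (f \<omega>) -` C)) \<in> borel_measurable N" for n
  proof -
    have fin: "emeasure (X \<omega>) (K n) < \<infinity>" if "\<omega> \<in> space N" for \<omega>
      using lfc[OF that] K(1) by (auto simp: locally_finite_counting_def)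
    have "C \<in> sigma_sets (space L \<times> space borel) {a \<times> b |a b. a \<in> sets L \<and> b \<in> sets (borel::'a measure)}"
      using C by (simp add: sets_pair_measure)
    then show ?thesis
    proof (induction C rule: sigma_sets_induct_disjoint[OF Int_stable_pair_measure_generator pair_measure_closed, consumes 1, case_names basic empty compl union])
      case (basic A)
      then obtain a b where A: "A = a \<times> b" "a \<in> sets L" "b \<in> sets (borel::'a measure)" by auto
      have "(\<lambda>\<omega>. indicator a (f \<omega>) * emeasure (X \<omega>) (K n \<inter> b)) \<in> borel_measurable N"
        using X f A K by measurable
      also have "(\<lambda>\<omega>. indicator a (f \<omega>) * emeasure (X \<omega>) (K n \<inter> b)) =
          (\<lambda>\<omega>. emeasure (X \<omega>) (K n \<inter> Pair (f \<omega>) -` A))"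
      proof
        fix \<omega>
        have "Pair (f \<omega>) -` A = (if f \<omega> \<in> a then b else {})" using A by auto
        then show "indicator a (f \<omega>) * emeasure (X \<omega>) (K n \<inter> b) =
            emeasure (X \<omega>) (K n \<inter> Pair (f \<omega>) -` A)" by (simp split: split_indicator)
      qed
      finally show ?case .
    next
      case empty
      then show ?case by simp
    next
      case (compl A)
      then have A: "A \<in> sets (L \<Otimes>\<^sub>M borel)" by (simp add: sets_pair_measure)
      have "(\<lambda>\<omega>. emeasure (X \<omega>) (K n) - emeasure (X \<omega>) (K n \<inter> Pair (f \<omega>) -` A)) \<in> borel_measurable N"
        using X K compl by measurable
      moreover have "emeasure (X \<omega>) (K n \<inter> Pair (f \<omega>) -` (space L \<times> space borel - A)) =
          emeasure (X \<omega>) (K n) - emeasure (X \<omega>) (K n \<inter> Pair (f \<omega>) -` A)" if "\<omega> \<in> space N" for \<omega>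
      proof -
        have "K n \<inter> Pair (f \<omega>) -` (space L \<times> space borel - A) = K n - K n \<inter> Pair (f \<omega>) -` A"
          using measurable_space[OF f that] by auto
        moreover have "emeasure (X \<omega>) (K n \<inter> Pair (f \<omega>) -` A) \<noteq> \<infinity>"
          using emeasure_mono[of "K n \<inter> Pair (f \<omega>) -` A" "K n" "X \<omega>"] fin[OF that] K(2)
          by (auto simp: sets that top_unique)
        ultimately show ?thesis
          using sect[OF A] K(2) by (simp add: emeasure_Diff sets that)
      qed
      ultimately show ?case by (simp cong: measurable_cong)
    next
      case (union A)
      then have A: "A i \<in> sets (L \<Otimes>\<^sub>M borel)" for i by (auto simp: sets_pair_measure)
      have "(\<lambda>\<omega>. \<Sum>i. emeasure (X \<omega>) (K n \<inter> Pair (f \<omega>) -` A i)) \<in> borel_measurable N"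
        using union by measurable
      moreover have "emeasure (X \<omega>) (K n \<inter> Pair (f \<omega>) -` (\<Union>i. A i)) =
          (\<Sum>i. emeasure (X \<omega>) (K n \<inter> Pair (f \<omega>) -` A i))" if "\<omega> \<in> space N" for \<omega>
      proof -
        have "(\<Sum>i. emeasure (X \<omega>) (K n \<inter> Pair (f \<omega>) -` A i)) =
            emeasure (X \<omega>) (\<Union>i. K n \<inter> Pair (f \<omega>) -` A i)"
          using A sect K(2) union(1)
          by (intro suminf_emeasure) (auto simp: sets that disjoint_family_on_def disjoint_iff)
        also have "(\<Union>i. K n \<inter> Pair (f \<omega>) -` A i) = K n \<inter> Pair (f \<omega>) -` (\<Union>i. A i)" by auto
        finally show ?thesis by simp
      qed
      ultimately show ?case by (simp cong: measurable_cong)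
    qed
  qed
  have "(\<lambda>\<omega>. SUP n. emeasure (X \<omega>) (K n \<inter> Pair (f \<omega>) -` C)) \<in> borel_measurable N"
    using part by measurable
  moreover have "(SUP n. emeasure (X \<omega>) (K n \<inter> Pair (f \<omega>) -` C)) = emeasure (X \<omega>) (Pair (f \<omega>) -` C)"
    if "\<omega> \<in> space N" for \<omega>
  proof -
    have "(SUP n. emeasure (X \<omega>) (K n \<inter> Pair (f \<omega>) -` C)) =
        emeasure (X \<omega>) (\<Union>n. K n \<inter> Pair (f \<omega>) -` C)"
      using K sect[OF C] by (intro SUP_emeasure_incseq) (auto simp: sets that incseq_def subset_iff)
    also have "(\<Union>n. K n \<inter> Pair (f \<omega>) -` C) = Pair (f \<omega>) -` C" using K(4) by auto
    finally show ?thesis .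
  qed
  ultimately show ?thesis by (simp cong: measurable_cong)
qed

text \<open>The count of \<open>A\<close> after the shift is the count of the section at \<open>f \<omega>\<close> of
  \<open>{(t, x). s t x \<in> A}\<close>. The inverse shift carries compact sets to compact sets, so the shifted
  measure is again locally finite. The lemma is used for points of the line and for unordered pairs.\<close>

lemma measurable_random_shift:
  fixes X :: "'w \<Rightarrow> 'a::topological_space measure" and K :: "nat \<Rightarrow> 'a set"
    and s :: "real \<Rightarrow> 'a \<Rightarrow> 'a"
  assumes X: "X \<in> N \<rightarrow>\<^sub>M config_space" and f: "f \<in> borel_measurable N"
    and K: "\<And>n. compact (K n)" "\<And>n. K n \<in> sets borel" "incseq K" "(\<Union>n. K n) = UNIV"
    and meas: "(\<lambda>(t, x). s t x) \<in> borel \<Otimes>\<^sub>M borel \<rightarrow>\<^sub>M borel"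
    and cont: "\<And>t. continuous_on UNIV (s t)"
    and inv: "\<And>t x. s (- t) (s t x) = x"
  shows "(\<lambda>\<omega>. distr (X \<omega>) borel (s (f \<omega>))) \<in> N \<rightarrow>\<^sub>M config_space"
proof (rule measurable_config_spaceI)
  have lfc: "locally_finite_counting (X \<omega>)" if "\<omega> \<in> space N" for \<omega>
    using measurable_config_spaceD[OF X that] .
  have sets: "sets (X \<omega>) = sets borel" "space (X \<omega>) = UNIV" if "\<omega> \<in> space N" for \<omega>
    using lfc[OF that] sets_eq_imp_space_eq[of "X \<omega>" borel] by (auto simp: locally_finite_counting_def)
  have s: "s t \<in> borel \<rightarrow>\<^sub>M borel" for t
    using cont by (rule borel_measurable_continuous_onI)
  have em: "emeasure (distr (X \<omega>) borel (s (f \<omega>))) A = emeasure (X \<omega>) (s (f \<omega>) -` A)"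
    if "\<omega> \<in> space N" "A \<in> sets borel" for \<omega> A
    using s sets[OF that(1)] that by (subst emeasure_distr) (auto cong: measurable_cong_sets)
  show "(\<lambda>\<omega>. emeasure (distr (X \<omega>) borel (s (f \<omega>))) A) \<in> borel_measurable N"
    if A: "A \<in> sets borel" for A
  proof -
    define C where "C = (\<lambda>(t, x). s t x) -` A \<inter> space (borel \<Otimes>\<^sub>M borel)"
    have "C \<in> sets (borel \<Otimes>\<^sub>M borel)" unfolding C_def using meas A by (rule measurable_sets)
    from measurable_emeasure_random_section[OF X f K this]
    have "(\<lambda>\<omega>. emeasure (X \<omega>) (Pair (f \<omega>) -` C)) \<in> borel_measurable N" .
    moreover have "Pair t -` C = s t -` A" for t by (auto simp: C_def space_pair_measure)
    ultimately show ?thesis using em A by (simp cong: measurable_cong)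
  qed
  show "locally_finite_counting (distr (X \<omega>) borel (s (f \<omega>)))" if \<omega>: "\<omega> \<in> space N" for \<omega>
    unfolding locally_finite_counting_def
  proof (intro conjI ballI allI impI)
    show "emeasure (distr (X \<omega>) borel (s (f \<omega>))) A = \<infinity> \<or> emeasure (distr (X \<omega>) borel (s (f \<omega>))) A \<in> \<nat>"
      if "A \<in> sets borel" for A
      using lfc[OF \<omega>] measurable_sets_borel[OF s that] by (auto simp: em \<omega> that locally_finite_counting_def)
    show "emeasure (distr (X \<omega>) borel (s (f \<omega>))) A < \<infinity>" if A: "compact A" for A
    proof (cases "A \<in> sets borel")
      case True
      have "s (f \<omega>) -` A = s (- f \<omega>) ` A"
      proof (intro set_eqI iffI)
        fix x assume "x \<in> s (f \<omega>) -` A"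
        then show "x \<in> s (- f \<omega>) ` A" using inv[of "f \<omega>" x] by (metis image_eqI vimage_eq)
      next
        fix x assume "x \<in> s (- f \<omega>) ` A"
        then show "x \<in> s (f \<omega>) -` A" using inv[of "- f \<omega>"] by auto
      qed
      then have "compact (s (f \<omega>) -` A)"
        using A cont by (auto intro!: compact_continuous_image continuous_on_subset[OF cont])
      then show ?thesis using lfc[OF \<omega>] by (simp add: em \<omega> True locally_finite_counting_def)
    next
      case False
      then show ?thesis by (simp add: emeasure_notin_sets)
    qed
  qed simp
qed

lemma measurable_translate:
  assumes X: "X \<in> N \<rightarrow>\<^sub>M config_space" and f: "f \<in> borel_measurable N"
  shows "(\<lambda>\<omega>. translate (f \<omega>) (X \<omega>)) \<in> N \<rightarrow>\<^sub>M config_space"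
  unfolding translate_def
proof (rule measurable_random_shift[OF X f, where K = "\<lambda>n. {- real n..real n}"])
  show "(\<Union>n. {- real n..real n}) = UNIV"
  proof (intro set_eqI iffI UNIV_I)
    fix x :: real
    obtain n where "\<bar>x\<bar> \<le> real n" using real_arch_simple by blast
    then show "x \<in> (\<Union>n. {- real n..real n})" by (auto intro!: exI[of _ n])
  qed
  show "(\<lambda>(u, x). x + u) \<in> borel \<Otimes>\<^sub>M borel \<rightarrow>\<^sub>M (borel :: real measure)" by measurable
  show "continuous_on UNIV (\<lambda>x::real. x + u)" for u by (intro continuous_intros)
qed (auto simp: incseq_def)

lemma map_uprod_eq: "map_uprod f e = Upair (f (lower_end e)) (f (upper_end e))"
  by (metis Upair_lower_upper map_uprod_simps)

lemma continuous_on_map_uprod_add: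
  "continuous_on UNIV (map_uprod (\<lambda>x. x + t) :: real uprod \<Rightarrow> real uprod)"
proof (rule continuous_on_uprodI)
  have "continuous_on UNIV (\<lambda>z. case (\<lambda>(x, y). (x + t, y + t)) z of (x, y) \<Rightarrow> Upair x (y::real))"
    by (rule continuous_on_compose2[OF continuous_on_Upair])
       (auto simp: case_prod_unfold intro!: continuous_intros)
  then show "continuous_on UNIV (\<lambda>(x, y). map_uprod (\<lambda>x. x + t) (Upair x (y::real)))"
    by (simp add: case_prod_unfold)
qed

lemma measurable_translate_pairs:
  assumes X: "X \<in> N \<rightarrow>\<^sub>M config_space" and f: "f \<in> borel_measurable N"
  shows "(\<lambda>\<omega>. translate_pairs (f \<omega>) (X \<omega>)) \<in> N \<rightarrow>\<^sub>M config_space"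
  unfolding translate_pairs_def
proof (rule measurable_random_shift[OF X f compact_pair_box pair_box_borel incseq_pair_box UN_pair_box])
  show "(\<lambda>(t, e). map_uprod (\<lambda>x. x + t) e) \<in> borel \<Otimes>\<^sub>M borel \<rightarrow>\<^sub>M (borel :: real uprod measure)"
  proof -
    have "(\<lambda>p. (\<lambda>(x, y). Upair x y) (lower_end (snd p) + fst p, upper_end (snd p) + fst p))
        \<in> borel \<Otimes>\<^sub>M borel \<rightarrow>\<^sub>M (borel :: real uprod measure)"
      by (rule measurable_compose[OF _ borel_measurable_Upair]) measurable
    then show ?thesis by (simp only: map_uprod_eq case_prod_unfold fst_conv snd_conv)
  qed
qed (simp_all add: continuous_on_map_uprod_add uprod.map_comp o_def uprod.map_ident)

lemma pair_singleton_borel: "{e :: real uprod} \<in> sets borel"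
proof -
  have "{e} = {e'. lower_end e' = lower_end e \<and> upper_end e' = upper_end e}"
    by (auto, metis Upair_lower_upper)
  also have "\<dots> \<in> sets borel" by measurable
  finally show ?thesis .
qed

lemma points_translate_pairs:
  assumes "locally_finite_counting m"
  shows "points (translate_pairs t m) = map_uprod (\<lambda>x. x + t) ` points m"
proof -
  have sets: "sets m = sets borel" "space m = UNIV"
    using assms sets_eq_imp_space_eq[of m borel] by (auto simp: locally_finite_counting_def)
  have cancel: "map_uprod (\<lambda>x. x + t) (map_uprod (\<lambda>x. x - t) e) = e"
    "map_uprod (\<lambda>x. x - t) (map_uprod (\<lambda>x. x + t) e) = e" for e :: "real uprod"
    by (simp_all add: uprod.map_comp o_def uprod.map_ident)
  have meas: "map_uprod (\<lambda>x. x + t) \<in> m \<rightarrow>\<^sub>M borel"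
    using borel_measurable_continuous_onI[OF continuous_on_map_uprod_add] sets
    by (simp cong: measurable_cong_sets)
  have em: "emeasure (translate_pairs t m) {e} = emeasure m {map_uprod (\<lambda>x. x - t) e}" for e
  proof -
    have "map_uprod (\<lambda>x. x + t) -` {e} = {map_uprod (\<lambda>x. x - t) e}"
      using cancel by auto
    then show ?thesis
      unfolding translate_pairs_def using meas pair_singleton_borel
      by (simp add: emeasure_distr sets)
  qed
  show ?thesis
  proof (intro set_eqI iffI)
    fix e assume "e \<in> points (translate_pairs t m)"
    then have "map_uprod (\<lambda>x. x - t) e \<in> points m" by (simp add: points_def em)
    then show "e \<in> map_uprod (\<lambda>x. x + t) ` points m"
      by (rule rev_image_eqI) (simp add: cancel)
  next
    fix e assume "e \<in> map_uprod (\<lambda>x. x + t) ` points m"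
    then show "e \<in> points (translate_pairs t m)"
      using cancel by (auto simp: points_def em)
  qed
qed

section \<open>Vertices of long edges\<close>

text \<open>For a vertex \<open>x\<close> with finitely many, and at least one, incident edges, membership means that the
  longest edge at \<open>x\<close> exceeds \<open>r\<close>. Unlike \<^const>\<open>longest_edge\<close>, a maximum whose value is
  arbitrary when the set of edges is infinite or empty, this set behaves well for every configuration.\<close>

definition long_vertices :: "real uprod measure \<Rightarrow> real \<Rightarrow> real set" where
  "long_vertices m r = {x. \<exists>e\<in>points m. x \<in> set_uprod e \<and> r < edge_length e}"

lemma long_vertices_meets_iff:
  assumes "locally_finite_counting m" and [measurable]: "A \<in> sets borel"
  shows "long_vertices m r \<inter> A \<noteq> {} \<longleftrightarrow>
    emeasure m {e. (lower_end e \<in> A \<or> upper_end e \<in> A) \<and> r < upper_end e - lower_end e} > 0"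
proof -
  have "{e. (lower_end e \<in> A \<or> upper_end e \<in> A) \<and> r < upper_end e - lower_end e} \<in> sets borel"
    by measurable
  from pair_atom_iff[OF assms(1) this] show ?thesis
    by (auto simp: long_vertices_def set_uprod_eq edge_length_eq disjoint_iff)
qed

lemma measurable_long_vertices_meets:
  assumes M [measurable]: "M \<in> N \<rightarrow>\<^sub>M config_space" and A [measurable]: "A \<in> sets borel"
  shows "Measurable.pred N (\<lambda>\<omega>. long_vertices (M \<omega>) r \<inter> A \<noteq> {})"
proof -
  have B: "{e. (lower_end e \<in> A \<or> upper_end e \<in> A) \<and> r < upper_end e - lower_end e} \<in> sets borel"
    by measurable
  note [measurable] = borel_measurable_emeasure_config[OF M B]
  have "Measurable.pred N (\<lambda>\<omega>. emeasure (M \<omega>)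
      {e. (lower_end e \<in> A \<or> upper_end e \<in> A) \<and> r < upper_end e - lower_end e} > 0)"
    by measurable
  then show ?thesis
    using long_vertices_meets_iff[OF measurable_config_spaceD[OF M] A] by (simp cong: measurable_cong)
qed

text \<open>Cardinality with values in the extended nonnegative reals, as it appears in the number of points
  desiring a site and in the Palm law.\<close>

abbreviation ecard :: "'a set \<Rightarrow> ennreal" where
  "ecard S \<equiv> emeasure (count_space UNIV) S"

lemma ecard_mono: "S \<subseteq> T \<Longrightarrow> ecard S \<le> ecard T"
  by (rule emeasure_mono) auto

lemma ecard_image: "inj_on f S \<Longrightarrow> ecard (f ` S) = ecard S"
  by (simp add: emeasure_count_space card_image finite_image_iff)

lemma ecard_image_le: "ecard (f ` S) \<le> ecard S"
  by (cases "finite S") (auto simp: emeasure_count_space card_image_le)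

lemma ecard_nat: "ecard (S :: nat set) = (\<Sum>i. of_bool (i \<in> S))"
proof -
  have "ecard S = (\<integral>\<^sup>+i. indicator S i \<partial>count_space UNIV)" by simp
  also have "\<dots> = (\<Sum>i. indicator S i)" by (rule nn_integral_count_space_nat)
  finally show ?thesis by (simp add: indicator_def)
qed

lemma floor_scale_inj_on:
  fixes F :: "real set"
  assumes "finite F"
  shows "\<exists>n. inj_on (\<lambda>x. \<lfloor>real (Suc n) * x\<rfloor>) F"
proof -
  \<comment> \<open>A bound for the inverse gaps; the diagonal contributes the harmless value \<open>1 / 0 = 0\<close>.\<close>
  define D where "D = (\<lambda>(x, y). 1 / \<bar>x - y\<bar>) ` (F \<times> F)"
  have "finite D" using assms by (simp add: D_def)
  then obtain b where b: "\<And>d. d \<in> D \<Longrightarrow> d \<le> b"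
    using bdd_above_finite[of D] by (auto simp: bdd_above_def)
  obtain n where n: "b \<le> real n" using real_arch_simple by blast
  have "inj_on (\<lambda>x. \<lfloor>real (Suc n) * x\<rfloor>) F"
  proof (rule inj_onI, rule ccontr)
    fix x y assume xy: "x \<in> F" "y \<in> F" "\<lfloor>real (Suc n) * x\<rfloor> = \<lfloor>real (Suc n) * y\<rfloor>" "x \<noteq> y"
    have "1 / \<bar>x - y\<bar> \<le> b" using xy by (intro b) (auto simp: D_def intro!: rev_image_eqI[of "(x, y)"])
    with n have "1 / \<bar>x - y\<bar> < real (Suc n)" by simp
    then have "1 < real (Suc n) * \<bar>x - y\<bar>" using xy by (simp add: divide_less_eq)
    also have "\<dots> = \<bar>real (Suc n) * x - real (Suc n) * y\<bar>"
      by (simp only: abs_mult right_diff_distrib[symmetric] abs_of_nat)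
    also have "\<dots> < 1" using xy(3) by linarith
    finally show False .
  qed
  then show ?thesis ..
qed

text \<open>Sorting the points of \<open>S\<close> into cells of width \<open>1 / (n + 1)\<close> and counting the occupied cells never
  gives more than the number of points, and a fine enough mesh separates any finite subset.
  Occupancy of a cell is a measurable event, so this turns the number of points into a measurable quantity
  without enumerating them. The cells are numbered by \<^typ>\<open>nat\<close> so that counting them is an ordinary series.\<close>

lemma ecard_eq_SUP_floor:
  fixes S :: "real set"
  shows "ecard S = (SUP n. ecard ((\<lambda>x. to_nat \<lfloor>real (Suc n) * x\<rfloor>) ` S))"
proof (rule antisym)
  let ?f = "\<lambda>n x. to_nat \<lfloor>real (Suc n) * x\<rfloor>"
  have fin: "of_nat (card F) \<le> (SUP n. ecard (?f n ` S))" if F: "finite F" "F \<subseteq> S" for F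
  proof -
    obtain n where "inj_on (\<lambda>x. \<lfloor>real (Suc n) * x\<rfloor>) F" using floor_scale_inj_on[OF F(1)] ..
    then have "inj_on (?f n) F" by (auto simp: inj_on_def)
    then have "of_nat (card F) = ecard (?f n ` F)"
      using F by (subst ecard_image) (auto simp: emeasure_count_space)
    also have "\<dots> \<le> ecard (?f n ` S)" using F by (intro ecard_mono) auto
    also have "\<dots> \<le> (SUP n. ecard (?f n ` S))" by (rule SUP_upper) simp
    finally show ?thesis .
  qed
  show "ecard S \<le> (SUP n. ecard (?f n ` S))"
  proof (cases "finite S")
    case True
    then show ?thesis using fin[of S] by (simp add: emeasure_count_space)
  next
    case inf: False
    have "of_nat k \<le> (SUP n. ecard (?f n ` S))" for k
      using infinite_arbitrarily_large[OF inf, of k] fin by metis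
    then have "\<not> (SUP n. ecard (?f n ` S)) < top"
      using ennreal_Ex_less_of_nat[of "SUP n. ecard (?f n ` S)"] leD by blast
    then have "(SUP n. ecard (?f n ` S)) = top" by (simp only: less_top[symmetric] not_not)
    then show ?thesis by (simp only: top_greatest)
  qed
  show "(SUP n. ecard (?f n ` S)) \<le> ecard S"
    by (intro SUP_least ecard_image_le)
qed

lemma measurable_ecard_long_vertices:
  assumes M: "M \<in> N \<rightarrow>\<^sub>M config_space" and A [measurable]: "A \<in> sets borel"
  shows "(\<lambda>\<omega>. ecard (long_vertices (M \<omega>) r \<inter> A)) \<in> borel_measurable N"
proof -
  let ?f = "\<lambda>n x::real. to_nat \<lfloor>real (Suc n) * x\<rfloor>"
  have [measurable]: "Measurable.pred N (\<lambda>\<omega>. i \<in> ?f n ` (long_vertices (M \<omega>) r \<inter> A))" for i n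
  proof -
    have "A \<inter> {x. ?f n x = i} \<in> sets borel" by measurable
    from measurable_long_vertices_meets[OF M this, of r]
    have "Measurable.pred N (\<lambda>\<omega>. long_vertices (M \<omega>) r \<inter> (A \<inter> {x. ?f n x = i}) \<noteq> {})" .
    also have "(\<lambda>\<omega>. long_vertices (M \<omega>) r \<inter> (A \<inter> {x. ?f n x = i}) \<noteq> {}) =
        (\<lambda>\<omega>. i \<in> ?f n ` (long_vertices (M \<omega>) r \<inter> A))" by (auto simp: fun_eq_iff)
    finally show ?thesis .
  qed
  show ?thesis
    unfolding ecard_eq_SUP_floor ecard_nat by measurable
qed

lemma long_vertices_translate:
  assumes "locally_finite_counting m"
  shows "long_vertices (translate_pairs t m) r = (\<lambda>x. x + t) ` long_vertices m r"
proof -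
  have "edge_length (map_uprod (\<lambda>x. x + t) e) = edge_length e" for e
    by (cases e) simp
  then show ?thesis
    unfolding long_vertices_def points_translate_pairs[OF assms]
    by (auto simp: uprod.set_map image_iff)
qed

text \<open>The set in \<open>[t, t + 1)\<close> is the shift by \<open>t\<close> of the set in \<open>[0, 1)\<close> of the unshifted scheme, and the count
  is a measurable function of the edge configuration alone, so equality in law can be applied to it.\<close>

lemma nn_integral_ecard_long_vertices_shift:
  assumes M: "M \<in> \<Omega> \<rightarrow>\<^sub>M config_space" and inv: "translation_invariant \<Omega> M"
  shows "(\<integral>\<^sup>+\<omega>. ecard (long_vertices (M \<omega>) r \<inter> {t..<t + 1}) \<partial>\<Omega>) =
    (\<integral>\<^sup>+\<omega>. ecard (long_vertices (M \<omega>) r \<inter> {0..<1}) \<partial>\<Omega>)"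
proof -
  let ?H = "\<lambda>m. ecard (long_vertices m r \<inter> {t..<t + 1})"
  have H: "?H \<in> borel_measurable config_space"
    by (rule measurable_ecard_long_vertices) auto
  have "(\<integral>\<^sup>+\<omega>. ?H (M \<omega>) \<partial>\<Omega>) = (\<integral>\<^sup>+m. ?H m \<partial>distr \<Omega> config_space M)"
    using H M by (simp add: nn_integral_distr)
  also have "\<dots> = (\<integral>\<^sup>+m. ?H m \<partial>distr \<Omega> config_space (\<lambda>\<omega>. translate_pairs t (M \<omega>)))"
    using inv by (simp add: translation_invariant_def)
  also have "\<dots> = (\<integral>\<^sup>+\<omega>. ?H (translate_pairs t (M \<omega>)) \<partial>\<Omega>)"
    using H measurable_translate_pairs[OF M, of "\<lambda>_. t"] by (simp add: nn_integral_distr)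
  also have "\<dots> = (\<integral>\<^sup>+\<omega>. ecard (long_vertices (M \<omega>) r \<inter> {0..<1}) \<partial>\<Omega>)"
  proof (rule nn_integral_cong)
    fix \<omega> assume "\<omega> \<in> space \<Omega>"
    then have "long_vertices (translate_pairs t (M \<omega>)) r = (\<lambda>x. x + t) ` long_vertices (M \<omega>) r"
      using measurable_config_spaceD[OF M] by (intro long_vertices_translate)
    then have "long_vertices (translate_pairs t (M \<omega>)) r \<inter> {t..<t + 1} =
        (\<lambda>x. x + t) ` (long_vertices (M \<omega>) r \<inter> {0..<1})" by auto
    then show "?H (translate_pairs t (M \<omega>)) = ecard (long_vertices (M \<omega>) r \<inter> {0..<1})"
      by (simp add: ecard_image)
  qed
  finally show ?thesis .
qed

lemma less_longest_edge_iff: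
  assumes "finite (incident (points m) x)" "incident (points m) x \<noteq> {}"
  shows "r < longest_edge m x \<longleftrightarrow> x \<in> long_vertices m r"
  using assms by (auto simp: longest_edge_def long_vertices_def Max_gr_iff incident_def)

text \<open>Local finiteness alone allows infinitely many edges at \<open>x\<close> whose other ends escape to infinity; a bound
  on their lengths confines them to a compact box.\<close>

lemma finite_incident_if_bounded:
  assumes lfc: "locally_finite_counting m" and x: "x \<notin> long_vertices m r"
  shows "finite (incident (points m) x)"
proof -
  obtain n where n: "\<bar>x\<bar> + r \<le> real n" using real_arch_simple by blast
  have "incident (points m) x \<subseteq> points m \<inter> pair_box n"
  proof
    fix e assume "e \<in> incident (points m) x"
    then have e: "e \<in> points m" "x = lower_end e \<or> x = upper_end e"
      by (auto simp: incident_def set_uprod_eq)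
    moreover have "upper_end e - lower_end e \<le> r"
      using x e by (auto simp: long_vertices_def set_uprod_eq edge_length_eq not_less)
    moreover have "lower_end e \<le> upper_end e" by (cases e) auto
    ultimately show "e \<in> points m \<inter> pair_box n" using n by (auto simp: pair_box_def)
  qed
  moreover have "finite (points m \<inter> pair_box n)"
    using lfc compact_pair_box pair_box_borel
    by (intro finite_atoms(1)) (auto simp: locally_finite_counting_def)
  ultimately show ?thesis by (rule finite_subset)
qed

text \<open>The two sums are \<open>\<lceil>l\<rceil> - 1\<close>, truncated at \<open>0\<close>, and \<open>\<lceil>l\<rceil>\<close>.\<close>

lemma layer_sum_bounds:
  fixes l :: real
  assumes "0 \<le> l"
  shows "(\<Sum>j. of_bool (real (Suc j) < l)) \<le> ennreal l" "ennreal l \<le> (\<Sum>j. of_bool (real j < l))"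
proof -
  have "{j. real (Suc j) < l} = {..<nat \<lceil>l\<rceil> - 1}"
    by (auto simp: less_diff_conv zless_nat_eq_int_zless less_ceiling_iff)
  then have "ecard {j. real (Suc j) < l} = of_nat (nat \<lceil>l\<rceil> - 1)" by (simp add: emeasure_count_space)
  then have "(\<Sum>j. of_bool (real (Suc j) < l)) = (of_nat (nat \<lceil>l\<rceil> - 1) :: ennreal)"
    unfolding ecard_nat mem_Collect_eq .
  also have "\<dots> \<le> ennreal l"
    using assms by (simp add: ennreal_of_nat_eq_real_of_nat) linarith
  finally show "(\<Sum>j. of_bool (real (Suc j) < l)) \<le> ennreal l" .
  have "{j. real j < l} = {..<nat \<lceil>l\<rceil>}"
    by (auto simp: zless_nat_eq_int_zless less_ceiling_iff)
  then have "ecard {j. real j < l} = of_nat (nat \<lceil>l\<rceil>)" by (simp add: emeasure_count_space)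
  then have "(\<Sum>j. of_bool (real j < l)) = (of_nat (nat \<lceil>l\<rceil>) :: ennreal)"
    unfolding ecard_nat mem_Collect_eq .
  moreover have "ennreal l \<le> of_nat (nat \<lceil>l\<rceil>)"
    using assms by (simp add: ennreal_of_nat_eq_real_of_nat)
  ultimately show "ennreal l \<le> (\<Sum>j. of_bool (real j < l))" by simp
qed

section \<open>The Palm law\<close>

text \<open>The Palm law is declared by its values on events, which become its measure only once they are
  known to be countably additive. For a fixed outcome the counts are additive; exchanging sum and
  expectation requires measurable integrands. These come from an enumeration of the points by
  measurable functions of \<open>P\<close>: almost surely the count is the series of indicators \<open>h A n\<close>.\<close>

lemma
  fixes \<Omega> :: "'a measure" and x :: "nat \<Rightarrow> real measure \<Rightarrow> real"
  assumes P: "P \<in> \<Omega> \<rightarrow>\<^sub>M config_space" and \<xi>: "\<xi> \<in> \<Omega> \<rightarrow>\<^sub>M config_space" and M: "M \<in> \<Omega> \<rightarrow>\<^sub>M config_space"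
    and x: "\<And>n. x n \<in> config_space \<rightarrow>\<^sub>M borel"
    and enum: "AE \<omega> in \<Omega>. bij_betw (\<lambda>n. x n (P \<omega>)) UNIV (points (P \<omega>))"
  shows space_palm_law: "space (palm_law \<Omega> P \<xi> M) = space (config_space \<Otimes>\<^sub>M config_space \<Otimes>\<^sub>M config_space)"
    and sets_palm_law: "sets (palm_law \<Omega> P \<xi> M) = sets (config_space \<Otimes>\<^sub>M config_space \<Otimes>\<^sub>M config_space)"
    and emeasure_palm_law: "A \<in> sets (config_space \<Otimes>\<^sub>M config_space \<Otimes>\<^sub>M config_space) \<Longrightarrow>
      emeasure (palm_law \<Omega> P \<xi> M) A = (\<integral>\<^sup>+\<omega>. ecard {x \<in> points (P \<omega>) \<inter> {0..<1}.
        (translate (- x) (P \<omega>), translate (- x) (\<xi> \<omega>), translate_pairs (- x) (M \<omega>)) \<in> A} \<partial>\<Omega>)"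
proof -
  let ?C = "config_space \<Otimes>\<^sub>M config_space \<Otimes>\<^sub>M config_space :: (real measure \<times> real measure \<times> real uprod measure) measure"
  show "space (palm_law \<Omega> P \<xi> M) = space ?C"
    by (simp add: palm_law_def)
  show "sets (palm_law \<Omega> P \<xi> M) = sets ?C"
    by (simp add: palm_law_def)
  define T :: "real \<Rightarrow> 'a \<Rightarrow> real measure \<times> real measure \<times> real uprod measure"
    where "T y \<omega> = (translate (- y) (P \<omega>), translate (- y) (\<xi> \<omega>), translate_pairs (- y) (M \<omega>))" for y \<omega>
  define S where "S A \<omega> = {y \<in> points (P \<omega>) \<inter> {0..<1}. T y \<omega> \<in> A}" for A \<omega>
  define h where "h A n \<omega> = (of_bool (x n (P \<omega>) \<in> {0..<1} \<and> T (x n (P \<omega>)) \<omega> \<in> A) :: ennreal)" for A n \<omega>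
  have xP [measurable]: "(\<lambda>\<omega>. x n (P \<omega>)) \<in> borel_measurable \<Omega>" for n
    using measurable_compose[OF P x] .
  have T [measurable]: "(\<lambda>\<omega>. T (x n (P \<omega>)) \<omega>) \<in> \<Omega> \<rightarrow>\<^sub>M ?C" for n
    unfolding T_def
    by (intro measurable_Pair measurable_translate measurable_translate_pairs P \<xi> M) measurable
  have h [measurable]: "h A n \<in> borel_measurable \<Omega>" if [measurable]: "A \<in> sets ?C" for A n
    unfolding h_def by measurable
  have ecard_S: "AE \<omega> in \<Omega>. ecard (S A \<omega>) = (\<Sum>n. h A n \<omega>)" for A
    using enum
  proof eventually_elim
    case (elim \<omega>)
    let ?I = "{n. x n (P \<omega>) \<in> {0..<1} \<and> T (x n (P \<omega>)) \<omega> \<in> A}"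
    have "S A \<omega> = (\<lambda>n. x n (P \<omega>)) ` ?I"
      using elim by (auto simp: S_def bij_betw_def)
    moreover have "inj_on (\<lambda>n. x n (P \<omega>)) ?I"
      using elim by (auto simp: bij_betw_def intro: inj_on_subset)
    ultimately show ?case by (simp add: ecard_image ecard_nat h_def)
  qed
  define \<kappa> where "\<kappa> A = (\<integral>\<^sup>+\<omega>. ecard (S A \<omega>) \<partial>\<Omega>)" for A
  have \<kappa>: "\<kappa> A = (\<Sum>n. \<integral>\<^sup>+\<omega>. h A n \<omega> \<partial>\<Omega>)" if A: "A \<in> sets ?C" for A
  proof -
    have "\<kappa> A = (\<integral>\<^sup>+\<omega>. (\<Sum>n. h A n \<omega>) \<partial>\<Omega>)"
      unfolding \<kappa>_def by (rule nn_integral_cong_AE[OF ecard_S])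
    also have "\<dots> = (\<Sum>n. \<integral>\<^sup>+\<omega>. h A n \<omega> \<partial>\<Omega>)"
      by (rule nn_integral_suminf[OF h[OF A]])
    finally show ?thesis .
  qed
  have \<kappa>_ca: "countably_additive (sets ?C) \<kappa>"
  proof (rule countably_additiveI)
    fix A :: "nat \<Rightarrow> _ set" assume A: "range A \<subseteq> sets ?C" "disjoint_family A" "(\<Union>i. A i) \<in> sets ?C"
    then have A': "A i \<in> sets ?C" for i by auto
    have "(\<Sum>i. \<kappa> (A i)) = (\<Sum>i. \<integral>\<^sup>+\<omega>. (\<Sum>n. h (A i) n \<omega>) \<partial>\<Omega>)"
      unfolding \<kappa>_def using nn_integral_cong_AE[OF ecard_S] by simp
    also have "\<dots> = (\<integral>\<^sup>+\<omega>. (\<Sum>i. \<Sum>n. h (A i) n \<omega>) \<partial>\<Omega>)"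
      by (intro nn_integral_suminf[symmetric] borel_measurable_suminf_order h A')
    also have "\<dots> = \<kappa> (\<Union>i. A i)"
      unfolding \<kappa>_def
    proof (rule nn_integral_cong_AE)
      have "AE \<omega> in \<Omega>. \<forall>i. ecard (S (A i) \<omega>) = (\<Sum>n. h (A i) n \<omega>)"
        using ecard_S by (simp add: AE_all_countable)
      then show "AE \<omega> in \<Omega>. (\<Sum>i. \<Sum>n. h (A i) n \<omega>) = ecard (S (\<Union>i. A i) \<omega>)"
      proof eventually_elim
        case (elim \<omega>)
        have "(\<Sum>i. ecard (S (A i) \<omega>)) = ecard (\<Union>i. S (A i) \<omega>)"
          using A(2) by (intro suminf_emeasure) (fastforce simp: disjoint_family_on_def S_def)+
        moreover have "(\<Union>i. S (A i) \<omega>) = S (\<Union>i. A i) \<omega>" by (auto simp: S_def)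
        ultimately show ?case using elim by simp
      qed
    qed
    finally show "(\<Sum>i. \<kappa> (A i)) = \<kappa> (\<Union>i. A i)" .
  qed
  have "palm_law \<Omega> P \<xi> M = measure_of (space ?C) (sets ?C) \<kappa>"
    by (simp add: palm_law_def \<kappa>_def[abs_def] S_def T_def)
  moreover have "positive (sets ?C) \<kappa>" by (simp add: positive_def \<kappa>_def S_def)
  ultimately show "emeasure (palm_law \<Omega> P \<xi> M) A = (\<integral>\<^sup>+\<omega>. ecard {x \<in> points (P \<omega>) \<inter> {0..<1}.
        (translate (- x) (P \<omega>), translate (- x) (\<xi> \<omega>), translate_pairs (- x) (M \<omega>)) \<in> A} \<partial>\<Omega>)"
    if "A \<in> sets ?C"
    using emeasure_measure_of_sigma[OF sets.sigma_algebra_axioms _ \<kappa>_ca that]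
    by (simp add: \<kappa>_def S_def T_def)
qed

section \<open>Finite mean of the Poisson process\<close>

lemma summable_nat_div_fact: "summable (\<lambda>k. real k / fact k)"
proof -
  have "summable (\<lambda>k. 1 / fact k :: real)"
    using summable_exp[of "1::real"] by (simp add: inverse_eq_divide)
  moreover have "real (Suc k) / fact (Suc k) = 1 / fact k" for k
    by (simp add: fact_Suc del: of_nat_Suc)
  ultimately show ?thesis by (subst summable_Suc_iff[symmetric]) simp
qed

text \<open>The probabilities of the counts give the mean as the series \<open>\<Sum>k. k * exp (- 1) / fact k\<close>.\<close>

lemma poisson_process_finite_mean:
  assumes "prob_space \<Omega>" and poisson: "poisson_process \<Omega> 1 P"
  shows "(\<integral>\<^sup>+\<omega>. emeasure (P \<omega>) {0..<1} \<partial>\<Omega>) < \<infinity>"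
proof -
  interpret prob_space \<Omega> by fact
  have P: "P \<in> \<Omega> \<rightarrow>\<^sub>M config_space"
    using poisson by (simp add: poisson_process_def point_process_def)
  define f where "f \<omega> = emeasure (P \<omega>) {0..<1}" for \<omega>
  have f [measurable]: "f \<in> borel_measurable \<Omega>"
    unfolding f_def by (rule borel_measurable_emeasure_config[OF P]) simp
  have prob: "prob {\<omega>\<in>space \<Omega>. f \<omega> = of_nat k} = exp (- 1) / fact k" for k :: nat
    using poisson by (simp add: poisson_process_def f_def)
  \<comment> \<open>Only finiteness excludes the value \<open>\<infinity>\<close>, so that the series over the natural numbers misses nothing.\<close>
  have "f \<omega> = (\<Sum>k. of_nat k * indicator {\<omega>\<in>space \<Omega>. f \<omega> = of_nat k} \<omega>)" if \<omega>: "\<omega> \<in> space \<Omega>" for \<omega>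
  proof -
    have lfc: "locally_finite_counting (P \<omega>)" using measurable_config_spaceD[OF P \<omega>] .
    have "f \<omega> \<le> emeasure (P \<omega>) {0..1}"
      unfolding f_def using lfc by (intro emeasure_mono) (auto simp: locally_finite_counting_def)
    also have "\<dots> < \<infinity>" using lfc by (simp add: locally_finite_counting_def)
    finally have "f \<omega> \<noteq> \<infinity>" by simp
    moreover have "f \<omega> = \<infinity> \<or> f \<omega> \<in> \<nat>" using lfc by (simp add: locally_finite_counting_def f_def)
    ultimately have "f \<omega> \<in> \<nat>" by blast
    then obtain n where n: "f \<omega> = of_nat n" by (auto elim: Nats_cases)
    have "(\<Sum>k. of_nat k * indicator {\<omega>\<in>space \<Omega>. f \<omega> = of_nat k} \<omega>) =
        (\<Sum>k\<in>{n}. of_nat k * indicator {\<omega>\<in>space \<Omega>. f \<omega> = of_nat k} \<omega> :: ennreal)"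
      by (rule suminf_finite) (auto simp: n indicator_def)
    then show ?thesis using \<omega> n by simp
  qed
  then have "(\<integral>\<^sup>+\<omega>. f \<omega> \<partial>\<Omega>) =
      (\<integral>\<^sup>+\<omega>. (\<Sum>k. of_nat k * indicator {\<omega>\<in>space \<Omega>. f \<omega> = of_nat k} \<omega>) \<partial>\<Omega>)"
    by (rule nn_integral_cong)
  also have "\<dots> = (\<Sum>k. \<integral>\<^sup>+\<omega>. of_nat k * indicator {\<omega>\<in>space \<Omega>. f \<omega> = of_nat k} \<omega> \<partial>\<Omega>)"
    by (rule nn_integral_suminf) measurable
  also have "\<dots> = (\<Sum>k. ennreal (exp (- 1) * (real k / fact k)))"
  proof (rule suminf_cong)
    fix k :: nat
    have "(\<integral>\<^sup>+\<omega>. of_nat k * indicator {\<omega>\<in>space \<Omega>. f \<omega> = of_nat k} \<omega> \<partial>\<Omega>) =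
        of_nat k * emeasure \<Omega> {\<omega>\<in>space \<Omega>. f \<omega> = of_nat k}"
      by (rule nn_integral_cmult_indicator) measurable
    also have "\<dots> = ennreal (real k) * ennreal (exp (- 1) / fact k)"
      by (simp only: emeasure_eq_measure prob) (simp only: ennreal_of_nat_eq_real_of_nat)
    also have "\<dots> = ennreal (exp (- 1) * (real k / fact k))"
      by (simp add: ennreal_mult'[symmetric] mult.commute)
    finally show "(\<integral>\<^sup>+\<omega>. of_nat k * indicator {\<omega>\<in>space \<Omega>. f \<omega> = of_nat k} \<omega> \<partial>\<Omega>) =
        ennreal (exp (- 1) * (real k / fact k))" .
  qed
  also have "\<dots> = ennreal (\<Sum>k. exp (- 1) * (real k / fact k))"
    by (intro suminf_ennreal2 summable_mult summable_nat_div_fact) simp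
  finally show ?thesis by (simp add: f_def)
qed

section \<open>Comparing both expectations with the tail sums\<close>

text \<open>Almost surely all marks are positive, and the marks are the degrees.\<close>

lemma matching_scheme_incident:
  assumes "prob_space \<Omega>" and "0 \<notin> set_pmf \<mu>"
    and marking: "iid_marking \<Omega> P \<mu> \<xi>" and scheme: "matching_scheme \<Omega> P \<xi> M"
  shows "AE \<omega> in \<Omega>. \<forall>x\<in>points (P \<omega>). finite (incident (points (M \<omega>)) x) \<and> incident (points (M \<omega>)) x \<noteq> {}"
proof -
  interpret prob_space \<Omega> by fact
  obtain x Y where enum: "AE \<omega> in \<Omega>. bij_betw (\<lambda>n. x n (P \<omega>)) (UNIV :: nat set) (points (P \<omega>))"
    and Y: "indep_vars (\<lambda>_. count_space UNIV) Y (UNIV :: nat set)"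
    and law: "\<And>n. distr \<Omega> (count_space UNIV) (Y n) = measure_pmf \<mu>"
    and marks: "AE \<omega> in \<Omega>. \<forall>n. emeasure (\<xi> \<omega>) {x n (P \<omega>)} = of_nat (Y n \<omega>)"
    using marking unfolding iid_marking_def by blast
  have Y_meas: "Y n \<in> \<Omega> \<rightarrow>\<^sub>M count_space UNIV" for n
    using Y by (simp add: indep_vars_def2)
  have "AE k in distr \<Omega> (count_space UNIV) (Y n). k \<noteq> 0" for n
    using assms(2) unfolding law AE_measure_pmf_iff by metis
  then have "AE \<omega> in \<Omega>. Y n \<omega> \<noteq> 0" for n
    by (rule AE_distrD[OF Y_meas])
  then have "AE \<omega> in \<Omega>. \<forall>n. Y n \<omega> \<noteq> 0"
    by (simp add: AE_all_countable)
  moreover have "AE \<omega> in \<Omega>. \<forall>y\<in>points (P \<omega>). finite (incident (points (M \<omega>)) y) \<and>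
      of_nat (card (incident (points (M \<omega>)) y)) = emeasure (\<xi> \<omega>) {y}"
    using scheme by (simp add: matching_scheme_def)
  ultimately show ?thesis
    using enum marks
  proof eventually_elim
    case (elim \<omega>)
    show ?case
    proof
      fix y assume y: "y \<in> points (P \<omega>)"
      then obtain n where n: "y = x n (P \<omega>)" using elim(3) by (auto simp: bij_betw_def)
      with elim y have fin: "finite (incident (points (M \<omega>)) y)"
        and deg: "of_nat (card (incident (points (M \<omega>)) y)) = (of_nat (Y n \<omega>) :: ennreal)" by auto
      from deg have "card (incident (points (M \<omega>)) y) = Y n \<omega>" by (simp only: of_nat_eq_iff)
      with elim(1) fin show "finite (incident (points (M \<omega>)) y) \<and> incident (points (M \<omega>)) y \<noteq> {}"
        by (metis card.empty)
    qed
  qed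
qed

text \<open>This replaces conditions on the points of \<open>P\<close> by functionals of \<open>M\<close>, the process whose law is
  invariant.\<close>

lemma long_vertices_matching_scheme:
  assumes "prob_space \<Omega>" and "0 \<notin> set_pmf \<mu>"
    and "iid_marking \<Omega> P \<mu> \<xi>" and scheme: "matching_scheme \<Omega> P \<xi> M"
  shows "AE \<omega> in \<Omega>. \<forall>r. long_vertices (M \<omega>) r = {x \<in> points (P \<omega>). r < longest_edge (M \<omega>) x}"
proof -
  have "AE \<omega> in \<Omega>. \<forall>e\<in>points (M \<omega>). set_uprod e \<subseteq> points (P \<omega>)"
    using scheme by (simp add: matching_scheme_def)
  with matching_scheme_incident[OF assms] show ?thesis
  proof eventually_elim
    case (elim \<omega>)
    have "long_vertices (M \<omega>) r \<subseteq> points (P \<omega>)" for r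
      using elim(2) by (auto simp: long_vertices_def)
    moreover have "x \<in> long_vertices (M \<omega>) r \<longleftrightarrow> r < longest_edge (M \<omega>) x" if "x \<in> points (P \<omega>)" for x r
      using less_longest_edge_iff elim(1) that by blast
    ultimately show ?case by blast
  qed
qed

lemma longest_edge_pos:
  assumes "prob_space \<Omega>" and "0 \<notin> set_pmf \<mu>"
    and "iid_marking \<Omega> P \<mu> \<xi>" and scheme: "matching_scheme \<Omega> P \<xi> M"
  shows "AE \<omega> in \<Omega>. \<forall>x\<in>points (P \<omega>). 0 < longest_edge (M \<omega>) x"
proof -
  have "AE \<omega> in \<Omega>. \<forall>e\<in>points (M \<omega>). proper_uprod e"
    using scheme by (auto simp: matching_scheme_def)
  with matching_scheme_incident[OF assms] show ?thesis
  proof eventually_elim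
    case (elim \<omega>)
    show ?case
    proof
      fix x assume "x \<in> points (P \<omega>)"
      with elim(1) have inc: "finite (incident (points (M \<omega>)) x)" "incident (points (M \<omega>)) x \<noteq> {}" by auto
      then obtain e where e: "e \<in> points (M \<omega>)" "x \<in> set_uprod e" by (auto simp: incident_def)
      have "0 < edge_length e" using e(1) elim(2) by (cases e) auto
      with e have "x \<in> long_vertices (M \<omega>) 0" by (auto simp: long_vertices_def)
      with less_longest_edge_iff[OF inc] show "0 < longest_edge (M \<omega>) x" by simp
    qed
  qed
qed

text \<open>The function \<open>\<phi>\<close> of the introduction.\<close>

definition mean_long :: "'w measure \<Rightarrow> ('w \<Rightarrow> real uprod measure) \<Rightarrow> real \<Rightarrow> ennreal" where
  "mean_long \<Omega> M r = (\<integral>\<^sup>+\<omega>. ecard (long_vertices (M \<omega>) r \<inter> {0..<1}) \<partial>\<Omega>)"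

lemma nn_integral_suminf_ecard_long_vertices:
  assumes M: "M \<in> \<Omega> \<rightarrow>\<^sub>M config_space" and "translation_invariant \<Omega> M"
  shows "(\<integral>\<^sup>+\<omega>. (\<Sum>j. ecard (long_vertices (M \<omega>) (r j) \<inter> {t j..<t j + 1})) \<partial>\<Omega>) =
    (\<Sum>j. mean_long \<Omega> M (r j))"
proof -
  have "(\<integral>\<^sup>+\<omega>. (\<Sum>j. ecard (long_vertices (M \<omega>) (r j) \<inter> {t j..<t j + 1})) \<partial>\<Omega>) =
      (\<Sum>j. \<integral>\<^sup>+\<omega>. ecard (long_vertices (M \<omega>) (r j) \<inter> {t j..<t j + 1}) \<partial>\<Omega>)"
    by (intro nn_integral_suminf measurable_ecard_long_vertices[OF M]) simp
  then show ?thesis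
    by (simp only: mean_long_def nn_integral_ecard_long_vertices_shift[OF assms])
qed

text \<open>Lower bound: points of \<open>[j, j + 1)\<close> with an edge longer than \<open>j + 1\<close> desire the origin, for distinct
  \<open>j\<close> these are distinct points, and the positive half-line suffices. Upper bound: every desiring point
  lies in \<open>[j, j + 1)\<close> or \<open>[- j - 1, - j)\<close> for some \<open>j\<close>, hence at distance at least \<open>j\<close> from
  the origin. The two half-lines account for the factor 2.\<close>

lemma expectation_desiring_bounds:
  assumes M: "M \<in> \<Omega> \<rightarrow>\<^sub>M config_space" and inv: "translation_invariant \<Omega> M"
    and long: "AE \<omega> in \<Omega>. \<forall>r. long_vertices (M \<omega>) r = {x \<in> points (P \<omega>). r < longest_edge (M \<omega>) x}"
  shows "(\<Sum>j. mean_long \<Omega> M (real (Suc j))) \<le> (\<integral>\<^sup>+\<omega>. number_desiring (P \<omega>) (M \<omega>) 0 \<partial>\<Omega>)"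
    and "(\<integral>\<^sup>+\<omega>. number_desiring (P \<omega>) (M \<omega>) 0 \<partial>\<Omega>) \<le> 2 * (\<Sum>j. mean_long \<Omega> M (real j))"
proof -
  \<comment> \<open>The right end of \<open>?L j\<close> is left unsimplified to match \<open>{t..<t + 1}\<close>.\<close>
  let ?R = "\<lambda>j. {real j..<real j + 1}" and ?L = "\<lambda>j. {- real j - 1..<- real j - 1 + 1}"
  have "(\<Sum>j. mean_long \<Omega> M (real (Suc j))) =
      (\<integral>\<^sup>+\<omega>. (\<Sum>j. ecard (long_vertices (M \<omega>) (real (Suc j)) \<inter> ?R j)) \<partial>\<Omega>)"
    by (rule nn_integral_suminf_ecard_long_vertices[OF M inv, symmetric])
  also have "\<dots> \<le> (\<integral>\<^sup>+\<omega>. number_desiring (P \<omega>) (M \<omega>) 0 \<partial>\<Omega>)"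
  proof (rule nn_integral_mono_AE, use long in eventually_elim)
    case (elim \<omega>)
    have disj: "i = j" if "x \<in> ?R i" "x \<in> ?R j" for x i j
      using that by auto
    have "(\<Sum>j. ecard (long_vertices (M \<omega>) (real (Suc j)) \<inter> ?R j)) =
        ecard (\<Union>j. long_vertices (M \<omega>) (real (Suc j)) \<inter> ?R j)"
      using disj by (intro suminf_emeasure) (auto simp: disjoint_family_on_def disjoint_iff)
    also have "\<dots> \<le> number_desiring (P \<omega>) (M \<omega>) 0"
      unfolding number_desiring_def using elim by (intro ecard_mono) (auto simp: desires_def)
    finally show ?case .
  qed
  finally show "(\<Sum>j. mean_long \<Omega> M (real (Suc j))) \<le> (\<integral>\<^sup>+\<omega>. number_desiring (P \<omega>) (M \<omega>) 0 \<partial>\<Omega>)" .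
  have "(\<integral>\<^sup>+\<omega>. number_desiring (P \<omega>) (M \<omega>) 0 \<partial>\<Omega>) \<le>
      (\<integral>\<^sup>+\<omega>. (\<Sum>j. ecard (long_vertices (M \<omega>) (real j) \<inter> ?R j)) +
        (\<Sum>j. ecard (long_vertices (M \<omega>) (real j) \<inter> ?L j)) \<partial>\<Omega>)"
  proof (rule nn_integral_mono_AE, use long in eventually_elim)
    case (elim \<omega>)
    let ?A = "\<lambda>j. long_vertices (M \<omega>) (real j) \<inter> ?R j"
    let ?B = "\<lambda>j. long_vertices (M \<omega>) (real j) \<inter> ?L j"
    have "{x \<in> points (P \<omega>). desires (M \<omega>) x 0} \<subseteq> (\<Union>j. ?A j) \<union> (\<Union>j. ?B j)"
    proof
      fix x assume "x \<in> {x \<in> points (P \<omega>). desires (M \<omega>) x 0}"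
      then have x: "x \<in> points (P \<omega>)" "\<bar>x\<bar> < longest_edge (M \<omega>) x" by (auto simp: desires_def)
      show "x \<in> (\<Union>j. ?A j) \<union> (\<Union>j. ?B j)"
      proof (cases "0 \<le> x")
        case True
        then have "x \<in> ?A (nat \<lfloor>x\<rfloor>)" using x elim by auto linarith+
        then show ?thesis by blast
      next
        case False
        then have "x \<in> ?B (nat (\<lceil>- x\<rceil> - 1))" using x elim by auto linarith+
        then show ?thesis by blast
      qed
    qed
    then have "number_desiring (P \<omega>) (M \<omega>) 0 \<le> ecard ((\<Union>j. ?A j) \<union> (\<Union>j. ?B j))"
      unfolding number_desiring_def by (rule ecard_mono)
    also have "\<dots> \<le> ecard (\<Union>j. ?A j) + ecard (\<Union>j. ?B j)"
      by (rule emeasure_subadditive) auto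
    also have "\<dots> \<le> (\<Sum>j. ecard (?A j)) + (\<Sum>j. ecard (?B j))"
      by (intro add_mono emeasure_subadditive_countably) auto
    finally show ?case .
  qed
  also have "\<dots> = (\<Sum>j. mean_long \<Omega> M (real j)) + (\<Sum>j. mean_long \<Omega> M (real j))"
  proof -
    have "(\<lambda>\<omega>. \<Sum>j. ecard (long_vertices (M \<omega>) (real j) \<inter> {t j..<t j + 1})) \<in> borel_measurable \<Omega>"
      for t :: "nat \<Rightarrow> real"
      by (intro borel_measurable_suminf_order measurable_ecard_long_vertices[OF M]) simp
    note nn_integral_add[OF this[of real] this[of "\<lambda>j. - real j - 1"]]
    then show ?thesis by (simp only: nn_integral_suminf_ecard_long_vertices[OF M inv])
  qed
  also have "\<dots> = 2 * (\<Sum>j. mean_long \<Omega> M (real j))" by (simp add: mult_2)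
  finally show "(\<integral>\<^sup>+\<omega>. number_desiring (P \<omega>) (M \<omega>) 0 \<partial>\<Omega>) \<le> 2 * (\<Sum>j. mean_long \<Omega> M (real j))" .
qed

text \<open>Shifting a point \<open>y\<close> of \<open>P\<close> to the origin turns \<open>y \<in> long_vertices m r\<close> into
  \<open>0 \<in> long_vertices m' r\<close>, so the Palm measure of the latter event is \<open>\<phi>(r)\<close>. Where the
  edges at the origin are nonempty and bounded in length, \<^const>\<open>longest_edge\<close> is a true maximum
  and lies between the two layer sums; this measurable event has full Palm measure.\<close>

lemma expectation_palm_longest_edge_bounds:
  fixes \<Omega> :: "'w measure" and x :: "nat \<Rightarrow> real measure \<Rightarrow> real"
  assumes P: "P \<in> \<Omega> \<rightarrow>\<^sub>M config_space" and \<xi>: "\<xi> \<in> \<Omega> \<rightarrow>\<^sub>M config_space" and M: "M \<in> \<Omega> \<rightarrow>\<^sub>M config_space"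
    and x: "\<And>n. x n \<in> config_space \<rightarrow>\<^sub>M borel"
    and enum: "AE \<omega> in \<Omega>. bij_betw (\<lambda>n. x n (P \<omega>)) UNIV (points (P \<omega>))"
    and long: "AE \<omega> in \<Omega>. \<forall>r. long_vertices (M \<omega>) r = {x \<in> points (P \<omega>). r < longest_edge (M \<omega>) x}"
    and pos: "AE \<omega> in \<Omega>. \<forall>x\<in>points (P \<omega>). 0 < longest_edge (M \<omega>) x"
  shows "(\<Sum>j. mean_long \<Omega> M (real (Suc j))) \<le>
      (\<integral>\<^sup>+(p, d, m). ennreal (longest_edge m 0) \<partial>palm_law \<Omega> P \<xi> M)"
    and "(\<integral>\<^sup>+(p, d, m). ennreal (longest_edge m 0) \<partial>palm_law \<Omega> P \<xi> M) \<le>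
      (\<Sum>j. mean_long \<Omega> M (real j))"
proof -
  let ?C = "config_space \<Otimes>\<^sub>M config_space \<Otimes>\<^sub>M config_space :: (real measure \<times> real measure \<times> real uprod measure) measure"
  define Q where "Q = palm_law \<Omega> P \<xi> M"
  have sets_Q: "sets Q = sets ?C" and space_Q: "space Q = space ?C"
    unfolding Q_def by (rule sets_palm_law[OF P \<xi> M x enum] space_palm_law[OF P \<xi> M x enum])+
  note em_Q = emeasure_palm_law[OF P \<xi> M x enum, folded Q_def]
  have m: "(\<lambda>z. snd (snd z)) \<in> Q \<rightarrow>\<^sub>M config_space"
    by (simp add: measurable_cong_sets[OF sets_Q refl])
  have pred [measurable]: "Measurable.pred Q (\<lambda>z. 0 \<in> long_vertices (snd (snd z)) r)" for r
    using measurable_long_vertices_meets[OF m, of "{0}" r] by simp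
  have shift: "0 \<in> long_vertices (translate_pairs (- y) (M \<omega>)) r \<longleftrightarrow> y \<in> long_vertices (M \<omega>) r"
    if "\<omega> \<in> space \<Omega>" for y \<omega> r
    using long_vertices_translate[OF measurable_config_spaceD[OF M that], of "- y" r] by (auto simp: image_iff)
  have shift_space: "(translate (- y) (P \<omega>), translate (- y) (\<xi> \<omega>), translate_pairs (- y) (M \<omega>)) \<in> space ?C"
    if "\<omega> \<in> space \<Omega>" for y \<omega>
    using that measurable_space[OF measurable_translate[OF P, of "\<lambda>_. - y"]]
      measurable_space[OF measurable_translate[OF \<xi>, of "\<lambda>_. - y"]]
      measurable_space[OF measurable_translate_pairs[OF M, of "\<lambda>_. - y"]]
    by (simp add: space_pair_measure)
  have tail: "emeasure Q {z\<in>space Q. 0 \<in> long_vertices (snd (snd z)) r} = mean_long \<Omega> M r" for r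
  proof -
    have "{z\<in>space Q. 0 \<in> long_vertices (snd (snd z)) r} \<in> sets Q" by measurable
    then have "emeasure Q {z\<in>space Q. 0 \<in> long_vertices (snd (snd z)) r} =
        (\<integral>\<^sup>+\<omega>. ecard {y \<in> points (P \<omega>) \<inter> {0..<1}.
          (translate (- y) (P \<omega>), translate (- y) (\<xi> \<omega>), translate_pairs (- y) (M \<omega>))
            \<in> {z\<in>space Q. 0 \<in> long_vertices (snd (snd z)) r}} \<partial>\<Omega>)"
      by (intro em_Q) (simp add: sets_Q)
    also have "\<dots> = mean_long \<Omega> M r"
      unfolding mean_long_def
    proof (rule nn_integral_cong_AE, use long AE_space in eventually_elim)
      case (elim \<omega>)
      then show ?case
        by (intro arg_cong[where f = ecard]) (auto simp: space_Q shift shift_space)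
    qed
    finally show ?thesis .
  qed
  let ?good = "\<lambda>z. 0 \<in> long_vertices (snd (snd z)) 0 \<and> (\<exists>j::nat. 0 \<notin> long_vertices (snd (snd z)) (real j))"
  have good: "AE z in Q. ?good z"
  proof (rule AE_I')
    have meas: "{z\<in>space Q. \<not> ?good z} \<in> sets Q" by measurable
    then have "emeasure Q {z\<in>space Q. \<not> ?good z} =
        (\<integral>\<^sup>+\<omega>. ecard {y \<in> points (P \<omega>) \<inter> {0..<1}.
          (translate (- y) (P \<omega>), translate (- y) (\<xi> \<omega>), translate_pairs (- y) (M \<omega>))
            \<in> {z\<in>space Q. \<not> ?good z}} \<partial>\<Omega>)"
      by (intro em_Q) (simp add: sets_Q)
    also have "\<dots> = (\<integral>\<^sup>+\<omega>. 0 \<partial>\<Omega>)"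
    proof (rule nn_integral_cong_AE, use long pos AE_space in eventually_elim)
      case (elim \<omega>)
      have "y \<in> long_vertices (M \<omega>) 0 \<and> (\<exists>j::nat. y \<notin> long_vertices (M \<omega>) (real j))"
        if "y \<in> points (P \<omega>)" for y
        using elim that real_arch_simple[of "longest_edge (M \<omega>) y"] by (auto simp: not_less)
      then have "{y \<in> points (P \<omega>) \<inter> {0..<1}.
          (translate (- y) (P \<omega>), translate (- y) (\<xi> \<omega>), translate_pairs (- y) (M \<omega>))
            \<in> {z\<in>space Q. \<not> ?good z}} = {}"
        using elim by (auto simp: shift)
      then show ?case by (simp only: emeasure_empty)
    qed
    finally show "{z\<in>space Q. \<not> ?good z} \<in> null_sets Q"
      using meas by (simp add: null_sets_def)
  qed simp
  have bounds: "AE z in Q.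
      (\<Sum>j. of_bool (0 \<in> long_vertices (snd (snd z)) (real (Suc j)))) \<le> ennreal (longest_edge (snd (snd z)) 0) \<and>
      ennreal (longest_edge (snd (snd z)) 0) \<le> (\<Sum>j. of_bool (0 \<in> long_vertices (snd (snd z)) (real j)))"
    using good AE_space
  proof eventually_elim
    case (elim z)
    let ?m = "snd (snd z)"
    have "locally_finite_counting ?m" using measurable_config_spaceD[OF m elim(2)] .
    then have "finite (incident (points ?m) 0)"
      using elim(1) finite_incident_if_bounded by blast
    moreover have "incident (points ?m) 0 \<noteq> {}"
      using elim(1) by (auto simp: long_vertices_def incident_def)
    ultimately have iff: "0 \<in> long_vertices ?m r \<longleftrightarrow> r < longest_edge ?m 0" for r
      using less_longest_edge_iff by blast
    then have "0 \<le> longest_edge ?m 0" using elim(1) less_imp_le by blast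
    from layer_sum_bounds[OF this] show ?case by (simp only: iff)
  qed
  have sum: "(\<integral>\<^sup>+z. (\<Sum>j. of_bool (0 \<in> long_vertices (snd (snd z)) (r j))) \<partial>Q) =
      (\<Sum>j. mean_long \<Omega> M (r j))" for r :: "nat \<Rightarrow> real"
  proof -
    have single: "(\<integral>\<^sup>+z. of_bool (0 \<in> long_vertices (snd (snd z)) (r j)) \<partial>Q) = mean_long \<Omega> M (r j)" for j
    proof -
      have "(\<integral>\<^sup>+z. of_bool (0 \<in> long_vertices (snd (snd z)) (r j)) \<partial>Q) =
          (\<integral>\<^sup>+z. indicator {z\<in>space Q. 0 \<in> long_vertices (snd (snd z)) (r j)} z \<partial>Q)"
        by (intro nn_integral_cong) (auto simp: indicator_def)
      also have "\<dots> = emeasure Q {z\<in>space Q. 0 \<in> long_vertices (snd (snd z)) (r j)}"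
        by (rule nn_integral_indicator) measurable
      finally show ?thesis by (simp only: tail)
    qed
    have "(\<integral>\<^sup>+z. (\<Sum>j. of_bool (0 \<in> long_vertices (snd (snd z)) (r j))) \<partial>Q) =
        (\<Sum>j. \<integral>\<^sup>+z. of_bool (0 \<in> long_vertices (snd (snd z)) (r j)) \<partial>Q)"
      by (rule nn_integral_suminf) measurable
    also have "\<dots> = (\<Sum>j. mean_long \<Omega> M (r j))" by (simp only: single)
    finally show ?thesis .
  qed
  show "(\<Sum>j. mean_long \<Omega> M (real (Suc j))) \<le>
      (\<integral>\<^sup>+(p, d, m). ennreal (longest_edge m 0) \<partial>palm_law \<Omega> P \<xi> M)"
    unfolding sum[symmetric] Q_def[symmetric]
    by (rule nn_integral_mono_AE, use bounds in eventually_elim) (simp add: case_prod_unfold)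
  show "(\<integral>\<^sup>+(p, d, m). ennreal (longest_edge m 0) \<partial>palm_law \<Omega> P \<xi> M) \<le>
      (\<Sum>j. mean_long \<Omega> M (real j))"
    unfolding sum[symmetric] Q_def[symmetric]
    by (rule nn_integral_mono_AE, use bounds in eventually_elim) (simp add: case_prod_unfold)
qed

text \<open>Every atom of \<open>P\<close> has mass at least 1, so the number of points in \<open>[0, 1)\<close> is at most the mass
  of \<open>[0, 1)\<close>.\<close>

lemma mean_long_finite:
  assumes "prob_space \<Omega>" and poisson: "poisson_process \<Omega> 1 P"
    and long: "AE \<omega> in \<Omega>. \<forall>r. long_vertices (M \<omega>) r = {x \<in> points (P \<omega>). r < longest_edge (M \<omega>) x}"
  shows "mean_long \<Omega> M r < \<infinity>"
proof -
  have P: "P \<in> \<Omega> \<rightarrow>\<^sub>M config_space"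
    using poisson by (simp add: poisson_process_def point_process_def)
  have "mean_long \<Omega> M r \<le> (\<integral>\<^sup>+\<omega>. emeasure (P \<omega>) {0..<1} \<partial>\<Omega>)"
    unfolding mean_long_def
  proof (rule nn_integral_mono_AE, use long AE_space in eventually_elim)
    case (elim \<omega>)
    have lfc: "locally_finite_counting (P \<omega>)" using measurable_config_spaceD[OF P elim(2)] .
    have "emeasure (P \<omega>) {0..<1} \<le> emeasure (P \<omega>) {0..1}"
      using lfc by (intro emeasure_mono) (auto simp: locally_finite_counting_def)
    also have "\<dots> < \<infinity>" using lfc by (simp add: locally_finite_counting_def)
    finally have fin: "emeasure (P \<omega>) {0..<1} < \<infinity>" .
    have "ecard (long_vertices (M \<omega>) r \<inter> {0..<1}) \<le> ecard (points (P \<omega>) \<inter> {0..<1})"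
      using elim(1) by (intro ecard_mono) auto
    also have "\<dots> \<le> emeasure (P \<omega>) {0..<1}"
      using finite_atoms[OF lfc _ fin] by (simp add: emeasure_count_space)
    finally show ?case .
  qed
  also have "\<dots> < \<infinity>" by (rule poisson_process_finite_mean[OF assms(1) poisson])
  finally show ?thesis .
qed

theorem lemma1p4:
  fixes \<Omega> :: "'w measure"
    and P \<xi> :: "'w \<Rightarrow> real measure"
    and M :: "'w \<Rightarrow> real uprod measure"
    and \<mu> :: "nat pmf"
  assumes "prob_space \<Omega>"
    and "poisson_process \<Omega> 1 P"
    and "0 \<notin> set_pmf \<mu>"
    and "iid_marking \<Omega> P \<mu> \<xi>"
    and "matching_scheme \<Omega> P \<xi> M"
    and "translation_invariant \<Omega> M"
  shows "(\<integral>\<^sup>+(p, d, m). ennreal (longest_edge m 0) \<partial>palm_law \<Omega> P \<xi> M) < \<infinity>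
    \<longleftrightarrow> (\<integral>\<^sup>+\<omega>. number_desiring (P \<omega>) (M \<omega>) 0 \<partial>\<Omega>) < \<infinity>"
proof -
  have P: "P \<in> \<Omega> \<rightarrow>\<^sub>M config_space" and M: "M \<in> \<Omega> \<rightarrow>\<^sub>M config_space" and \<xi>: "\<xi> \<in> \<Omega> \<rightarrow>\<^sub>M config_space"
    using assms by (auto simp: poisson_process_def matching_scheme_def iid_marking_def point_process_def)
  obtain x :: "nat \<Rightarrow> real measure \<Rightarrow> real" where x: "\<And>n. x n \<in> config_space \<rightarrow>\<^sub>M borel"
    and enum: "AE \<omega> in \<Omega>. bij_betw (\<lambda>n. x n (P \<omega>)) UNIV (points (P \<omega>))"
    using assms(4) unfolding iid_marking_def by blast
  note long = long_vertices_matching_scheme[OF assms(1,3,4,5)]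
  note pos = longest_edge_pos[OF assms(1,3,4,5)]
  let ?t = "\<lambda>j. mean_long \<Omega> M (real j)"
  have "(\<Sum>j. ?t j) = (\<Sum>j. ?t (j + 1)) + (\<Sum>j<1. ?t j)"
    by (rule suminf_offset) simp
  moreover have "?t 0 < \<infinity>" by (rule mean_long_finite[OF assms(1,2) long])
  \<comment> \<open>The lower bounds control the sum only from \<open>j = 1\<close> on; the missing term is finite.\<close>
  ultimately have tail: "(\<Sum>j. ?t j) < \<infinity> \<longleftrightarrow> (\<Sum>j. ?t (Suc j)) < \<infinity>"
    by (simp add: ennreal_add_eq_top less_top)
  have "(\<integral>\<^sup>+(p, d, m). ennreal (longest_edge m 0) \<partial>palm_law \<Omega> P \<xi> M) < \<infinity> \<longleftrightarrow> (\<Sum>j. ?t j) < \<infinity>"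
    using expectation_palm_longest_edge_bounds[OF P \<xi> M x enum long pos] tail
    by (meson le_less_trans)
  moreover have "(\<integral>\<^sup>+\<omega>. number_desiring (P \<omega>) (M \<omega>) 0 \<partial>\<Omega>) < \<infinity> \<longleftrightarrow> (\<Sum>j. ?t j) < \<infinity>"
  proof
    assume "(\<integral>\<^sup>+\<omega>. number_desiring (P \<omega>) (M \<omega>) 0 \<partial>\<Omega>) < \<infinity>"
    then show "(\<Sum>j. ?t j) < \<infinity>"
      using expectation_desiring_bounds(1)[OF M assms(6) long] tail by (meson le_less_trans)
  next
    assume "(\<Sum>j. ?t j) < \<infinity>"
    then have "2 * (\<Sum>j. ?t j) < \<infinity>" by (simp add: ennreal_mult_less_top)
    then show "(\<integral>\<^sup>+\<omega>. number_desiring (P \<omega>) (M \<omega>) 0 \<partial>\<Omega>) < \<infinity>"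
      using expectation_desiring_bounds(2)[OF M assms(6) long] by (rule le_less_trans[rotated])
  qed
  ultimately show ?thesis by simp
qed

end
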